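(* Let $N\ge2$. The operators $(S_i)_{i\in\mathbb{Z}_N}$ on the Hilbert space $\mathcal{H}(\mathcal{K}_N)$ of $\sigma$-functions given by $S_i(f\sqrt{d\mu})=(f\circ\sigma)\sqrt{d(\mu\circ\sigma_i^{-1})}$ are isometries defining a representation of the Cuntz algebra $\mathcal{O}_N$. The adjoints are given by $$S_i^*(f\sqrt{d\mu})=(f\circ\sigma_i)\sqrt{d(\mu|_{\sigma_i(\mathcal{K}_N)}\circ\sigma^{-1})},$$ where $\mu|_A$ denotes the restriction of the measure $\mu$ to the Borel set $A$, i.e. $\mu|_A(B)=\mu(A\cap B)$ for all Borel $B\subset\mathcal{K}_N$. The projection valued measure $P$ associated to this representation is given by $$P(A)(f\sqrt{d\mu})=\chi_Af\sqrt{d\mu}$$ for all Borel sets $A\subset\mathcal{K}_N$.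
   Context: Let $\mathbb{Z}_N=\{0,1,\dots,N-1\}$. A representation of $\mathcal{O}_N$ on a Hilbert space is a family of isometries $(S_i)_{i\in\mathbb{Z}_N}$ with $S_i^*S_j=\delta_{ij}I$ and $\sum_{i}S_iS_i^*=I$. For a finite word $I=i_1\dots i_n$, $S_I:=S_{i_1}\cdots S_{i_n}$. Let $\mathcal{K}_N=\prod_1^\infty\mathbb{Z}_N$ be the compact space of infinite words (product topology), $\sigma(\omega_1\omega_2\dots)=\omega_2\omega_3\dots$, and $\sigma_i(\omega_1\omega_2\dots)=i\omega_1\omega_2\dots$ for $i\in\mathbb{Z}_N$; $\mathcal{C}(I)=\{\omega:\omega_1=i_1,\dots,\omega_n=i_n\}$. For a measure $\mu$ and a measurable map $\tau$, $\mu\circ\tau^{-1}$ denotes the push-forward $A\mapsto\mu(\tau^{-1}(A))$. The projection valued measure associated to a representation of $\mathcal{O}_N$ is the unique projection valued measure $P$ on the Borel $\sigma$-algebra of $\mathcal{K}_N$ with $P(\mathcal{C}(I))=S_IS_I^*$ for every finite word $I$. The Hilbert space $\mathcal{H}(\mathcal{K}_N)$ of $\sigma$-functions: consider pairs $(f,\mu)$ with $\mu$ a finite Borel measure on $\mathcal{K}_N$ and $f\in L^2(\mu)$. Say $(f,\mu)\sim(g,\nu)$ if there is a (finite Borel) measure $\lambda$ with $\mu,\nu\ll\lambda$ and $f\sqrt{\frac{d\mu}{d\lambda}}=g\sqrt{\frac{d\nu}{d\lambda}}$ $\lambda$-a.e. The class of $(f,\mu)$ is denoted $f\sqrt{d\mu}$;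 $\mathcal{H}(\mathcal{K}_N)$ is the set of all classes, with addition $f\sqrt{d\mu}+g\sqrt{d\nu}=\big(f\sqrt{\frac{d\mu}{d\lambda}}+g\sqrt{\frac{d\nu}{d\lambda}}\big)\sqrt{d\lambda}$ and inner product $\langle f\sqrt{d\mu},g\sqrt{d\nu}\rangle=\int\overline{f}g\sqrt{\frac{d\mu}{d\lambda}}\sqrt{\frac{d\nu}{d\lambda}}\,d\lambda$, for any $\lambda$ with $\mu,\nu\ll\lambda$. *)

theory Defs
  imports "HOL-Analysis.Analysis" "HOL-Algebra.Algebraic_Closure_Type"
begin

section \<open>Complex Hilbert spaces with an explicit carrier\<close>

text \<open>
  Vector spaces are modules over the field of complex numbers in the sense of the library of
  abstract algebra. The multiplication and unit that the module record inherits from the ring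
  record play no role. The inner product is conjugate linear in its first argument.
\<close>

record 'v hilbert_struct = "(complex, 'v) module" +
  hinner :: "'v \<Rightarrow> 'v \<Rightarrow> complex"

definition hnorm :: "('v, 'm) hilbert_struct_scheme \<Rightarrow> 'v \<Rightarrow> real" where
  "hnorm H x = sqrt (Re (hinner H x x))"

definition hconverges ::
    "('v, 'm) hilbert_struct_scheme \<Rightarrow> (nat \<Rightarrow> 'v) \<Rightarrow> 'v \<Rightarrow> bool" where
  "hconverges H u x \<longleftrightarrow> (\<lambda>n. hnorm H (u n \<ominus>\<^bsub>H\<^esub> x)) \<longlonglongrightarrow> 0"

locale complex_hilbert_space =
  Module.module "ring_of_type_algebra :: complex ring" H
  for H :: "('v, 'm) hilbert_struct_scheme" (structure) +
  assumes hinner_commute: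
      "\<lbrakk>x \<in> carrier H; y \<in> carrier H\<rbrakk> \<Longrightarrow> hinner H y x = cnj (hinner H x y)"
    and hinner_add_right:
      "\<lbrakk>x \<in> carrier H; y \<in> carrier H; z \<in> carrier H\<rbrakk>
        \<Longrightarrow> hinner H x (y \<oplus>\<^bsub>H\<^esub> z) = hinner H x y + hinner H x z"
    and hinner_smult_right:
      "\<lbrakk>x \<in> carrier H; y \<in> carrier H\<rbrakk> \<Longrightarrow> hinner H x (c \<odot>\<^bsub>H\<^esub> y) = c * hinner H x y"
    and hinner_nonneg: "x \<in> carrier H \<Longrightarrow> 0 \<le> Re (hinner H x x)"
    and hinner_definite: "\<lbrakk>x \<in> carrier H; hinner H x x = 0\<rbrakk> \<Longrightarrow> x = \<zero>\<^bsub>H\<^esub>"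
    and hilbert_complete:
      "\<lbrakk>\<And>n. u n \<in> carrier H;
        \<And>e. 0 < e \<Longrightarrow> \<exists>M. \<forall>m\<ge>M. \<forall>n\<ge>M. hnorm H (u m \<ominus>\<^bsub>H\<^esub> u n) < e\<rbrakk>
        \<Longrightarrow> \<exists>x\<in>carrier H. hconverges H u x"

definition linear_operator :: "('v, 'm) hilbert_struct_scheme \<Rightarrow> ('v \<Rightarrow> 'v) \<Rightarrow> bool" where
  "linear_operator H T \<longleftrightarrow>
     (\<forall>x\<in>carrier H. T x \<in> carrier H) \<and>
     (\<forall>x\<in>carrier H. \<forall>y\<in>carrier H. T (x \<oplus>\<^bsub>H\<^esub> y) = T x \<oplus>\<^bsub>H\<^esub> T y) \<and>
     (\<forall>c. \<forall>x\<in>carrier H. T (c \<odot>\<^bsub>H\<^esub> x) = c \<odot>\<^bsub>H\<^esub> T x)"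

definition linear_isometry :: "('v, 'm) hilbert_struct_scheme \<Rightarrow> ('v \<Rightarrow> 'v) \<Rightarrow> bool" where
  "linear_isometry H T \<longleftrightarrow>
     linear_operator H T \<and> (\<forall>x\<in>carrier H. hnorm H (T x) = hnorm H x)"

definition hadjoint :: "('v, 'm) hilbert_struct_scheme \<Rightarrow> ('v \<Rightarrow> 'v) \<Rightarrow> 'v \<Rightarrow> 'v" where
  "hadjoint H T y =
     (THE z. z \<in> carrier H \<and> (\<forall>x\<in>carrier H. hinner H (T x) y = hinner H x z))"

definition orthogonal_projection :: "('v, 'm) hilbert_struct_scheme \<Rightarrow> ('v \<Rightarrow> 'v) \<Rightarrow> bool" where
  "orthogonal_projection H T \<longleftrightarrow>
     linear_operator H T \<and>
     (\<forall>x\<in>carrier H. T (T x) = T x) \<and>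
     (\<forall>x\<in>carrier H. \<forall>y\<in>carrier H. hinner H (T x) y = hinner H x (T y))"

text \<open>Countable additivity is with respect to the strong operator topology.\<close>

locale projection_valued_measure = complex_hilbert_space H
  for H :: "('v, 'm) hilbert_struct_scheme" (structure) +
  fixes M :: "'w measure" and P :: "'w set \<Rightarrow> 'v \<Rightarrow> 'v"
  assumes pvm_projection: "A \<in> sets M \<Longrightarrow> orthogonal_projection H (P A)"
    and pvm_space: "x \<in> carrier H \<Longrightarrow> P (space M) x = x"
    and pvm_Int:
      "\<lbrakk>A \<in> sets M; B \<in> sets M; x \<in> carrier H\<rbrakk> \<Longrightarrow> P (A \<inter> B) x = P A (P B x)"
    and pvm_countably_additive:
      "\<lbrakk>range F \<subseteq> sets M; disjoint_family F; x \<in> carrier H\<rbrakk>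
        \<Longrightarrow> hconverges H (\<lambda>n. \<Oplus>\<^bsub>H\<^esub>k\<in>{..<n}. P (F k) x) (P (\<Union>k::nat. F k) x)"


section \<open>Representations of the Cuntz algebra\<close>

locale cuntz_representation = complex_hilbert_space H
  for H :: "('v, 'm) hilbert_struct_scheme" (structure) +
  fixes N :: nat and S :: "nat \<Rightarrow> 'v \<Rightarrow> 'v"
  assumes cuntz_isometry: "i < N \<Longrightarrow> linear_isometry H (S i)"
    and cuntz_orthogonal:
      "\<lbrakk>i < N; j < N; x \<in> carrier H\<rbrakk>
        \<Longrightarrow> hadjoint H (S i) (S j x) = (if i = j then x else \<zero>\<^bsub>H\<^esub>)"
    and cuntz_sum:
      "x \<in> carrier H \<Longrightarrow> (\<Oplus>\<^bsub>H\<^esub>i\<in>{..<N}. S i (hadjoint H (S i) x)) = x"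

definition word_operator :: "(nat \<Rightarrow> 'v \<Rightarrow> 'v) \<Rightarrow> nat list \<Rightarrow> 'v \<Rightarrow> 'v" where
  "word_operator S I = foldr (\<lambda>i T. S i \<circ> T) I id"

text \<open>
  Infinite words are functions on the natural numbers, with letters indexed from 0. The type
  \<^typ>\<open>nat \<Rightarrow> nat\<close> carries the product topology of the discrete topology,
  so \<open>word_borel N\<close> is the Borel sigma-algebra of the product space \<open>words N\<close>.
\<close>

definition words :: "nat \<Rightarrow> (nat \<Rightarrow> nat) set" where
  "words N = {\<omega>. \<forall>k. \<omega> k < N}"

definition word_borel :: "nat \<Rightarrow> (nat \<Rightarrow> nat) measure" where
  "word_borel N = restrict_space borel (words N)"

definition shift :: "(nat \<Rightarrow> nat) \<Rightarrow> nat \<Rightarrow> nat" where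
  "shift \<omega> = (\<lambda>k. \<omega> (Suc k))"

definition prepend :: "nat \<Rightarrow> (nat \<Rightarrow> nat) \<Rightarrow> nat \<Rightarrow> nat" where
  "prepend i \<omega> = case_nat i \<omega>"

definition cylinder :: "nat \<Rightarrow> nat list \<Rightarrow> (nat \<Rightarrow> nat) set" where
  "cylinder N I = {\<omega> \<in> words N. \<forall>k<length I. \<omega> k = I ! k}"

text \<open>
  The associated projection valued measure is characterised by its values on cylinders.
\<close>

definition associated_pvm ::
    "('v, 'm) hilbert_struct_scheme \<Rightarrow> nat \<Rightarrow> (nat \<Rightarrow> 'v \<Rightarrow> 'v)
      \<Rightarrow> ((nat \<Rightarrow> nat) set \<Rightarrow> 'v \<Rightarrow> 'v) \<Rightarrow> bool" where
  "associated_pvm H N S P \<longleftrightarrow>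
     projection_valued_measure H (word_borel N) P \<and>
     (\<forall>I. set I \<subseteq> {..<N} \<longrightarrow>
        (\<forall>x\<in>carrier H.
           P (cylinder N I) x = word_operator S I (hadjoint H (word_operator S I) x)))"


section \<open>The Hilbert space of sigma-functions\<close>

definition finite_word_measures :: "nat \<Rightarrow> (nat \<Rightarrow> nat) measure set" where
  "finite_word_measures N = {\<mu>. finite_measure \<mu> \<and> sets \<mu> = sets (word_borel N)}"

type_synonym sigma_pair = "((nat \<Rightarrow> nat) \<Rightarrow> complex) \<times> (nat \<Rightarrow> nat) measure"

definition sigma_pairs :: "nat \<Rightarrow> sigma_pair set" where
  "sigma_pairs N =
     {(f, \<mu>). \<mu> \<in> finite_word_measures N \<and> f \<in> borel_measurable \<mu> \<and>
        integrable \<mu> (\<lambda>\<omega>. (cmod (f \<omega>))\<^sup>2)}"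

definition sqrt_deriv ::
    "(nat \<Rightarrow> nat) measure \<Rightarrow> (nat \<Rightarrow> nat) measure \<Rightarrow> (nat \<Rightarrow> nat) \<Rightarrow> complex" where
  "sqrt_deriv \<mu> \<kappa> \<omega> = of_real (sqrt (enn2real (RN_deriv \<kappa> \<mu> \<omega>)))"

definition dominates ::
    "nat \<Rightarrow> (nat \<Rightarrow> nat) measure \<Rightarrow> (nat \<Rightarrow> nat) measure \<Rightarrow> (nat \<Rightarrow> nat) measure \<Rightarrow> bool" where
  "dominates N \<kappa> \<mu> \<nu> \<longleftrightarrow>
     \<kappa> \<in> finite_word_measures N \<and> absolutely_continuous \<kappa> \<mu> \<and> absolutely_continuous \<kappa> \<nu>"

definition sigma_rel :: "nat \<Rightarrow> (sigma_pair \<times> sigma_pair) set" where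
  "sigma_rel N =
     {((f, \<mu>), (g, \<nu>)). (f, \<mu>) \<in> sigma_pairs N \<and> (g, \<nu>) \<in> sigma_pairs N \<and>
        (\<exists>\<kappa>. dominates N \<kappa> \<mu> \<nu> \<and>
           (AE \<omega> in \<kappa>. f \<omega> * sqrt_deriv \<mu> \<kappa> \<omega> = g \<omega> * sqrt_deriv \<nu> \<kappa> \<omega>))}"

text \<open>The class of the pair \<open>(f, \<mu>)\<close>, usually written as f times the square root of
  \<open>d\<mu>\<close>.\<close>

definition sigma_fun ::
    "nat \<Rightarrow> ((nat \<Rightarrow> nat) \<Rightarrow> complex) \<Rightarrow> (nat \<Rightarrow> nat) measure \<Rightarrow> sigma_pair set" where
  "sigma_fun N f \<mu> = sigma_rel N `` {(f, \<mu>)}"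

text \<open>
  The operations are defined through representatives: the definite descriptions are meaningful
  only because the described value does not depend on the representatives, nor on the
  dominating measure.
\<close>

definition sigma_add :: "nat \<Rightarrow> sigma_pair set \<Rightarrow> sigma_pair set \<Rightarrow> sigma_pair set" where
  "sigma_add N u v =
     (THE Z. \<forall>f \<mu> g \<nu> \<kappa>. (f, \<mu>) \<in> u \<longrightarrow> (g, \<nu>) \<in> v \<longrightarrow> dominates N \<kappa> \<mu> \<nu> \<longrightarrow>
        Z = sigma_fun N (\<lambda>\<omega>. f \<omega> * sqrt_deriv \<mu> \<kappa> \<omega> + g \<omega> * sqrt_deriv \<nu> \<kappa> \<omega>) \<kappa>)"

definition sigma_scale :: "nat \<Rightarrow> complex \<Rightarrow> sigma_pair set \<Rightarrow> sigma_pair set" where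
  "sigma_scale N c u =
     (THE Z. \<forall>f \<mu>. (f, \<mu>) \<in> u \<longrightarrow> Z = sigma_fun N (\<lambda>\<omega>. c * f \<omega>) \<mu>)"

definition sigma_inner :: "nat \<Rightarrow> sigma_pair set \<Rightarrow> sigma_pair set \<Rightarrow> complex" where
  "sigma_inner N u v =
     (THE c. \<forall>f \<mu> g \<nu> \<kappa>. (f, \<mu>) \<in> u \<longrightarrow> (g, \<nu>) \<in> v \<longrightarrow> dominates N \<kappa> \<mu> \<nu> \<longrightarrow>
        c = (LINT \<omega>|\<kappa>. cnj (f \<omega>) * g \<omega> * sqrt_deriv \<mu> \<kappa> \<omega> * sqrt_deriv \<nu> \<kappa> \<omega>))"

definition sigma_space :: "nat \<Rightarrow> sigma_pair set hilbert_struct" where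
  "sigma_space N =
     \<lparr>carrier = sigma_pairs N // sigma_rel N, mult = undefined, one = undefined,
      zero = sigma_fun N (\<lambda>_. 0) (null_measure (word_borel N)), add = sigma_add N,
      smult = sigma_scale N, hinner = sigma_inner N\<rparr>"

definition sigma_S :: "nat \<Rightarrow> nat \<Rightarrow> sigma_pair set \<Rightarrow> sigma_pair set" where
  "sigma_S N i u =
     (THE Z. \<forall>f \<mu>. (f, \<mu>) \<in> u \<longrightarrow>
        Z = sigma_fun N (f \<circ> shift) (distr \<mu> (word_borel N) (prepend i)))"

text \<open>Unlike \<^const>\<open>restrict_space\<close>, this keeps the underlying measurable space.\<close>

definition restrict_meas :: "'w measure \<Rightarrow> 'w set \<Rightarrow> 'w measure" where
  "restrict_meas \<mu> A = measure_of (space \<mu>) (sets \<mu>) (\<lambda>B. emeasure \<mu> (A \<inter> B))"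

end

theory Submission
  imports Defs
begin

text \<open>
  Countably many finite measures have a common dominating finite measure \<open>\<kappa>\<close>, and every class
  \<open>(f, \<mu>)\<close> with \<open>\<mu>\<close> dominated by \<open>\<kappa>\<close> equals \<open>(h, \<kappa>)\<close> for the square integrable
  function \<open>h\<close> obtained by multiplying \<open>f\<close> with the root of the density. Hence every
  assertion about countably many sigma-functions, completeness included, is one about a single
  space of square integrable functions. A Borel isomorphism \<open>a\<close> from \<open>A\<close> onto \<open>B\<close> with inverse
  \<open>b\<close> acts on sigma-functions by sending \<open>(f, \<mu>)\<close> to \<open>f \<circ> b\<close> with the push-forward of the
  restriction of \<open>\<mu>\<close> to \<open>A\<close>; this is a partial isometry whose adjoint belongs to the inverse
  isomorphism, and composition of maps becomes composition of operators. All Cuntz relations are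
  therefore identities between partial maps of words, and the operator of a word followed by
  its adjoint is multiplication by the indicator function of the cylinder. As the cylinders
  generate the Borel sets, a projection valued measure is determined by its values on them.
\<close>

section \<open>Densities with respect to a dominating measure\<close>

text \<open>The obstacle is well-definedness. Every operation is a definite description over all
  representatives and, for sums and inner products, over all dominating measures, while
  Radon-Nikodym derivatives are fixed only almost everywhere. Two dominating measures need not be
  comparable, so they are compared over a third one above both, where the chain rule for roots of
  densities supplies a common factor. In a composition of transports the measures agree exactly, but
  the functions agree only almost everywhere, since the inverse maps are controlled only on the
  ranges. Adjoints are also definite descriptions; they are found by exhibiting the vector, with
  uniqueness from definiteness of the inner product. For uniqueness of the projection valued measure
  the cylinders need the empty set to become stable under intersection. Its projection is the
  product of those of the disjoint cylinders of the letters 0 and 1, which is where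
  \<open>N \<ge> 2\<close> enters. Complements then require finite additivity, extracted from strong
  countable additivity by uniqueness of limits.\<close>

lemma finite_word_measuresD:
  assumes "\<mu> \<in> finite_word_measures N"
  shows "finite_measure \<mu>" "sigma_finite_measure \<mu>" "sets \<mu> = sets (word_borel N)" "space \<mu> = words N"
proof -
  show 1: "finite_measure \<mu>" and 2: "sets \<mu> = sets (word_borel N)"
    using assms by (auto simp: finite_word_measures_def)
  then interpret finite_measure \<mu> by simp
  show "sigma_finite_measure \<mu>" by unfold_locales
  show "space \<mu> = words N"
    using sets_eq_imp_space_eq[OF 2] by (simp add: word_borel_def space_restrict_space)
qed

lemma space_word_borel [simp]: "space (word_borel N) = words N"
  by (simp add: word_borel_def space_restrict_space)

lemma sqrt_deriv_measurable [measurable]: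
  "sqrt_deriv \<mu> \<kappa> \<in> borel_measurable \<kappa>"
  unfolding sqrt_deriv_def[abs_def] by measurable

lemma sqrt_deriv_measurable_word_borel:
  assumes "\<kappa> \<in> finite_word_measures N"
  shows "sqrt_deriv \<mu> \<kappa> \<in> borel_measurable (word_borel N)"
  using sqrt_deriv_measurable finite_word_measuresD(3)[OF assms]
  by (metis measurable_cong_sets)

text \<open>Uniqueness of the Radon-Nikodym derivative up to null sets; this replaces the abstract
  derivative by an explicit density whenever one is known.\<close>

lemma sqrt_deriv_density:
  assumes \<kappa>: "\<kappa> \<in> finite_word_measures N" and [measurable]: "p \<in> borel_measurable \<kappa>"
    and nonneg: "\<And>x. 0 \<le> p x" and \<mu>: "\<mu> = density \<kappa> (\<lambda>x. ennreal (p x))"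
  shows "AE x in \<kappa>. sqrt_deriv \<mu> \<kappa> x = of_real (sqrt (p x))"
proof -
  interpret sigma_finite_measure \<kappa> using finite_word_measuresD[OF \<kappa>] by simp
  have "AE x in \<kappa>. ennreal (p x) = RN_deriv \<kappa> \<mu> x"
    by (rule RN_deriv_unique) (use \<mu> in auto)
  then show ?thesis
  proof (rule AE_mp, intro AE_I2 impI)
    fix x assume "ennreal (p x) = RN_deriv \<kappa> \<mu> x"
    then have "enn2real (RN_deriv \<kappa> \<mu> x) = p x" using nonneg by (metis enn2real_ennreal)
    then show "sqrt_deriv \<mu> \<kappa> x = of_real (sqrt (p x))" by (simp add: sqrt_deriv_def)
  qed
qed

lemma density_sqrt_deriv:
  assumes \<kappa>: "\<kappa> \<in> finite_word_measures N" and \<mu>: "\<mu> \<in> finite_word_measures N"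
    and ac: "absolutely_continuous \<kappa> \<mu>"
  shows "\<mu> = density \<kappa> (\<lambda>x. ennreal ((cmod (sqrt_deriv \<mu> \<kappa> x))\<^sup>2))"
proof -
  interpret sigma_finite_measure \<kappa> using finite_word_measuresD[OF \<kappa>] by simp
  have s: "sets \<mu> = sets \<kappa>" using finite_word_measuresD \<kappa> \<mu> by metis
  \<comment> \<open>\<open>enn2real\<close> sends infinity to 0, so squaring
    \<open>sqrt_deriv\<close> recovers the derivative only where it is finite; sigma-finiteness of
    \<open>\<mu>\<close> makes this almost everywhere.\<close>
  have "AE x in \<kappa>. RN_deriv \<kappa> \<mu> x \<noteq> \<infinity>"
    by (rule RN_deriv_finite[OF _ ac s]) (rule finite_word_measuresD(2)[OF \<mu>])
  then have "AE x in \<kappa>. ennreal ((cmod (sqrt_deriv \<mu> \<kappa> x))\<^sup>2) = RN_deriv \<kappa> \<mu> x"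
    by (auto simp: sqrt_deriv_def less_top)
  then have "density \<kappa> (\<lambda>x. ennreal ((cmod (sqrt_deriv \<mu> \<kappa> x))\<^sup>2)) = density \<kappa> (RN_deriv \<kappa> \<mu>)"
    by (intro density_cong) auto
  then show ?thesis using density_RN_deriv[OF ac s] by simp
qed

lemma sqrt_deriv_eq_of_real: "sqrt_deriv \<mu> \<kappa> x = of_real (cmod (sqrt_deriv \<mu> \<kappa> x))"
  by (simp add: sqrt_deriv_def)

lemma cnj_sqrt_deriv [simp]: "cnj (sqrt_deriv \<mu> \<kappa> x) = sqrt_deriv \<mu> \<kappa> x"
  by (simp add: sqrt_deriv_def)

lemma sqrt_deriv_mult_self:
  "sqrt_deriv \<mu> \<kappa> x * sqrt_deriv \<mu> \<kappa> x = of_real ((cmod (sqrt_deriv \<mu> \<kappa> x))\<^sup>2)"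
  by (simp add: sqrt_deriv_def power2_eq_square flip: of_real_mult)

lemma sqrt_deriv_self:
  assumes \<kappa>: "\<kappa> \<in> finite_word_measures N"
  shows "AE x in \<kappa>. sqrt_deriv \<kappa> \<kappa> x = 1"
  using sqrt_deriv_density[OF \<kappa>, of "\<lambda>_. 1" \<kappa>] by (simp add: density_1)

text \<open>Chain rule for Radon-Nikodym derivatives: a density of a density is a product, and the
  root is multiplicative. It is the tool for changing the dominating measure.\<close>

lemma sqrt_deriv_chain:
  assumes \<mu>: "\<mu> \<in> finite_word_measures N" and \<kappa>: "\<kappa> \<in> finite_word_measures N"
    and \<rho>: "\<rho> \<in> finite_word_measures N"
    and ac: "absolutely_continuous \<kappa> \<mu>" "absolutely_continuous \<rho> \<kappa>"
  shows "AE x in \<rho>. sqrt_deriv \<mu> \<rho> x = sqrt_deriv \<mu> \<kappa> x * sqrt_deriv \<kappa> \<rho> x"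
proof -
  let ?p = "\<lambda>x. (cmod (sqrt_deriv \<mu> \<kappa> x))\<^sup>2" and ?r = "\<lambda>x. (cmod (sqrt_deriv \<kappa> \<rho> x))\<^sup>2"
  have s: "sets \<rho> = sets \<kappa>" using finite_word_measuresD \<kappa> \<rho> by metis
  have [measurable]: "sqrt_deriv \<mu> \<kappa> \<in> borel_measurable \<rho>"
    using sqrt_deriv_measurable measurable_cong_sets[OF s refl] by blast
  have "\<mu> = density (density \<rho> (\<lambda>x. ennreal (?r x))) (\<lambda>x. ennreal (?p x))"
    using density_sqrt_deriv[OF \<kappa> \<mu> ac(1)] density_sqrt_deriv[OF \<rho> \<kappa> ac(2)] by metis
  also have "\<dots> = density \<rho> (\<lambda>x. ennreal (?r x * ?p x))"
    by (subst density_density_eq) (auto simp: ennreal_mult)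
  finally have "AE x in \<rho>. sqrt_deriv \<mu> \<rho> x = of_real (sqrt (?r x * ?p x))"
    by (intro sqrt_deriv_density[OF \<rho>]) auto
  then show ?thesis
    by (rule AE_mp) (auto intro!: AE_I2 simp: real_sqrt_mult sqrt_deriv_eq_of_real[symmetric])
qed

text \<open>\<open>\<kappa>\<close> has density \<open>(sqrt_deriv \<kappa> \<rho>)\<^sup>2\<close>
  with respect to \<open>\<rho>\<close>, so it ignores exactly the zeros of that density and the
  \<open>\<rho>\<close>-null sets.\<close>

lemma AE_abs_cont_iff:
  assumes \<kappa>: "\<kappa> \<in> finite_word_measures N" and \<rho>: "\<rho> \<in> finite_word_measures N"
    and ac: "absolutely_continuous \<rho> \<kappa>"
  shows "(AE x in \<kappa>. P x) \<longleftrightarrow> (AE x in \<rho>. sqrt_deriv \<kappa> \<rho> x \<noteq> 0 \<longrightarrow> P x)"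
  by (subst density_sqrt_deriv[OF \<rho> \<kappa> ac], subst AE_density) auto

section \<open>Common dominating measures\<close>

text \<open>A weighted sum of the given measures with strictly positive weights: null sets of the
  sum are null for each summand, and the weights are small enough to keep the total mass
  finite.\<close>

lemma ex_dominating_measure:
  fixes \<mu> :: "nat \<Rightarrow> (nat \<Rightarrow> nat) measure"
  assumes \<mu>: "\<And>n. \<mu> n \<in> finite_word_measures N"
  shows "\<exists>\<kappa>\<in>finite_word_measures N. \<forall>n. absolutely_continuous \<kappa> (\<mu> n)"
proof -
  let ?W = "word_borel N"
  have s: "sets (\<mu> n) = sets ?W" for n using finite_word_measuresD \<mu> by metis
  \<comment> \<open>The weight gives the \<open>n\<close>-th summand total mass at most
    \<open>(1/2)^n\<close>; adding 1 in the denominator keeps it positive even for the zero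
    measure.\<close>
  define c where "c n = (1/2)^n / (1 + measure (\<mu> n) (words N))" for n
  have c0: "c n > 0" for n
    unfolding c_def by (intro divide_pos_pos add_pos_nonneg) auto
  define m where "m A = (\<Sum>n. ennreal (c n) * emeasure (\<mu> n) A)" for A
  define \<kappa> where "\<kappa> = measure_of (space ?W) (sets ?W) m"
  have em: "emeasure \<kappa> A = m A" if A: "A \<in> sets ?W" for A
    unfolding \<kappa>_def
  proof (rule emeasure_measure_of_sigma)
    show "sigma_algebra (space ?W) (sets ?W)" by (rule sets.sigma_algebra_axioms)
    show "positive (sets ?W) m" by (simp add: positive_def m_def)
    show "countably_additive (sets ?W) m"
    proof (rule countably_additiveI)
      fix F :: "nat \<Rightarrow> _" assume F: "range F \<subseteq> sets ?W" "disjoint_family F"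
      have "(\<Sum>k. m (F k)) = (\<integral>\<^sup>+k. (\<Sum>n. ennreal (c n) * emeasure (\<mu> n) (F k)) \<partial>count_space UNIV)"
        by (simp add: nn_integral_count_space_nat m_def)
      also have "\<dots> = (\<Sum>n. \<integral>\<^sup>+k. ennreal (c n) * emeasure (\<mu> n) (F k) \<partial>count_space UNIV)"
        by (rule nn_integral_suminf) auto
      also have "\<dots> = (\<Sum>n. ennreal (c n) * emeasure (\<mu> n) (\<Union>k. F k))"
        using F s by (simp add: nn_integral_count_space_nat suminf_emeasure)
      finally show "(\<Sum>k. m (F k)) = m (\<Union>k. F k)" by (simp add: m_def)
    qed
  qed (use A in auto)
  have sk: "sets \<kappa> = sets ?W" unfolding \<kappa>_def by (rule sets.sets_measure_of_eq)
  then have spk: "space \<kappa> = words N" by (metis sets_eq_imp_space_eq space_word_borel)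
  have "m (words N) \<le> (\<Sum>n. ennreal ((1/2)^n))"
    unfolding m_def
  proof (intro suminf_le)
    fix n
    interpret finite_measure "\<mu> n" using finite_word_measuresD \<mu> by blast
    have "ennreal (c n) * emeasure (\<mu> n) (words N) = ennreal (c n * measure (\<mu> n) (words N))"
      using c0[of n] by (simp add: emeasure_eq_measure ennreal_mult)
    also have "\<dots> \<le> ennreal ((1/2)^n)"
    proof (rule ennreal_leI)
      have "measure (\<mu> n) (words N) / (1 + measure (\<mu> n) (words N)) \<le> 1"
        by (simp add: divide_le_eq_1 add_pos_nonneg)
      then have "(1/2)^n * (measure (\<mu> n) (words N) / (1 + measure (\<mu> n) (words N))) \<le> (1/2)^n * 1"
        by (intro mult_left_mono) auto
      then show "c n * measure (\<mu> n) (words N) \<le> (1/2)^n" by (simp add: c_def)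
    qed
    finally show "ennreal (c n) * emeasure (\<mu> n) (words N) \<le> ennreal ((1/2)^n)" .
  qed auto
  also have "\<dots> = ennreal (\<Sum>n. (1/2)^n)"
    by (rule suminf_ennreal2) (auto intro: summable_geometric)
  also have "\<dots> < \<infinity>" by simp
  finally have "finite_measure \<kappa>"
    by (intro finite_measureI) (use spk em[of "words N"] sets.top[of ?W] in auto)
  then have "\<kappa> \<in> finite_word_measures N" using sk by (simp add: finite_word_measures_def)
  moreover have "absolutely_continuous \<kappa> (\<mu> n)" for n
    unfolding absolutely_continuous_def
  proof
    fix A assume A: "A \<in> null_sets \<kappa>"
    then have As: "A \<in> sets ?W" using sk by auto
    then have "m A = 0" using A em by auto
    then have "ennreal (c n) * emeasure (\<mu> n) A = 0"
      unfolding m_def by (subst (asm) suminf_eq_zero_iff) auto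
    then show "A \<in> null_sets (\<mu> n)" using c0[of n] As s by (auto simp: null_sets_def)
  qed
  ultimately show ?thesis by blast
qed

lemma ex_dominating_measure_finite:
  assumes "finite C" "C \<subseteq> finite_word_measures N" "C \<noteq> {}"
  shows "\<exists>\<kappa>\<in>finite_word_measures N. \<forall>m\<in>C. absolutely_continuous \<kappa> m"
proof -
  \<comment> \<open>A nonempty finite set is the range of a sequence with repetitions, so the
    countable case applies.\<close>
  obtain m where "C = range (m :: nat \<Rightarrow> _)"
    using assms countable_finite uncountable_def by metis
  then show ?thesis using ex_dominating_measure[of m N] assms by auto
qed

lemma absolutely_continuous_trans:
  "absolutely_continuous \<kappa> \<mu> \<Longrightarrow> absolutely_continuous \<mu> \<nu> \<Longrightarrow> absolutely_continuous \<kappa> \<nu>"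
  by (auto simp: absolutely_continuous_def)

section \<open>Classes of sigma-functions and the operations on them\<close>

lemma sigma_pairsD:
  assumes "(f, \<mu>) \<in> sigma_pairs N"
  shows "\<mu> \<in> finite_word_measures N" "f \<in> borel_measurable \<mu>"
    "integrable \<mu> (\<lambda>\<omega>. (cmod (f \<omega>))\<^sup>2)" "f \<in> borel_measurable (word_borel N)"
  using assms measurable_cong_sets[OF _ refl, of \<mu> "word_borel N"]
  by (auto simp: sigma_pairs_def finite_word_measures_def)

lemma sigma_pairsI:
  assumes "\<mu> \<in> finite_word_measures N" "f \<in> borel_measurable (word_borel N)"
    "integrable \<mu> (\<lambda>\<omega>. (cmod (f \<omega>))\<^sup>2)"
  shows "(f, \<mu>) \<in> sigma_pairs N"
  using assms measurable_cong_sets[OF _ refl, of \<mu> "word_borel N"]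
  by (auto simp: sigma_pairs_def finite_word_measures_def)

lemma dominatesD:
  assumes "dominates N \<kappa> \<mu> \<nu>"
  shows "\<kappa> \<in> finite_word_measures N" "absolutely_continuous \<kappa> \<mu>" "absolutely_continuous \<kappa> \<nu>"
  using assms by (auto simp: dominates_def)

lemma ex_dominates_pairs:
  assumes "finite C" "C \<subseteq> sigma_pairs N" "C \<noteq> {}"
  shows "\<exists>\<kappa>\<in>finite_word_measures N. \<forall>(f, m)\<in>C. absolutely_continuous \<kappa> m"
proof -
  have "snd ` C \<subseteq> finite_word_measures N" using assms(2) by (auto simp: sigma_pairs_def)
  then show ?thesis
    using ex_dominating_measure_finite[of "snd ` C" N] assms by fastforce
qed

text \<open>The squared root is the density of \<open>\<mu>\<close>, so the square integral of the
  new function against \<open>\<kappa>\<close> is that of \<open>f\<close> against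
  \<open>\<mu>\<close>.\<close>

lemma sigma_pairs_sqrt_deriv:
  assumes f: "(f, \<mu>) \<in> sigma_pairs N" and \<kappa>: "\<kappa> \<in> finite_word_measures N"
    and ac: "absolutely_continuous \<kappa> \<mu>"
  shows "(\<lambda>\<omega>. f \<omega> * sqrt_deriv \<mu> \<kappa> \<omega>, \<kappa>) \<in> sigma_pairs N"
proof -
  note [measurable] = sigma_pairsD(4)[OF f] sqrt_deriv_measurable_word_borel[OF \<kappa>]
  have s: "sets \<kappa> = sets (word_borel N)" using finite_word_measuresD \<kappa> by blast
  have [measurable]: "f \<in> borel_measurable \<kappa>"
    using sigma_pairsD(4)[OF f] measurable_cong_sets[OF s refl] by blast
  have "integrable (density \<kappa> (\<lambda>x. ennreal ((cmod (sqrt_deriv \<mu> \<kappa> x))\<^sup>2))) (\<lambda>\<omega>. (cmod (f \<omega>))\<^sup>2)"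
    using density_sqrt_deriv[OF \<kappa> sigma_pairsD(1)[OF f] ac] sigma_pairsD(3)[OF f] by metis
  then have "integrable \<kappa> (\<lambda>\<omega>. (cmod (sqrt_deriv \<mu> \<kappa> \<omega>))\<^sup>2 * (cmod (f \<omega>))\<^sup>2)"
    by (subst (asm) integrable_density) auto
  then show ?thesis
    by (intro sigma_pairsI[OF \<kappa>]) (auto simp: norm_mult power_mult_distrib mult.commute)
qed

text \<open>By the chain rule, passing from \<open>\<kappa>\<close> to \<open>\<rho>\<close>
  multiplies both sides by \<open>sqrt_deriv \<kappa> \<rho>\<close>. Where this factor vanishes the
  equation over \<open>\<rho>\<close> is trivial, and that region is null for
  \<open>\<kappa>\<close>.\<close>

lemma sigma_rel_dominates_mono:
  assumes f: "(f, \<mu>) \<in> sigma_pairs N" and g: "(g, \<nu>) \<in> sigma_pairs N"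
    and \<kappa>: "dominates N \<kappa> \<mu> \<nu>" and \<rho>: "\<rho> \<in> finite_word_measures N" "absolutely_continuous \<rho> \<kappa>"
  shows "(AE \<omega> in \<kappa>. f \<omega> * sqrt_deriv \<mu> \<kappa> \<omega> = g \<omega> * sqrt_deriv \<nu> \<kappa> \<omega>) \<longleftrightarrow>
    (AE \<omega> in \<rho>. f \<omega> * sqrt_deriv \<mu> \<rho> \<omega> = g \<omega> * sqrt_deriv \<nu> \<rho> \<omega>)" (is "?L \<longleftrightarrow> ?R")
proof -
  note d = dominatesD[OF \<kappa>]
  have 1: "AE x in \<rho>. sqrt_deriv \<mu> \<rho> x = sqrt_deriv \<mu> \<kappa> x * sqrt_deriv \<kappa> \<rho> x"
    by (rule sqrt_deriv_chain[OF sigma_pairsD(1)[OF f] d(1) \<rho>(1) d(2) \<rho>(2)])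
  have 2: "AE x in \<rho>. sqrt_deriv \<nu> \<rho> x = sqrt_deriv \<nu> \<kappa> x * sqrt_deriv \<kappa> \<rho> x"
    by (rule sqrt_deriv_chain[OF sigma_pairsD(1)[OF g] d(1) \<rho>(1) d(3) \<rho>(2)])
  have "?L \<longleftrightarrow> (AE \<omega> in \<rho>. sqrt_deriv \<kappa> \<rho> \<omega> \<noteq> 0 \<longrightarrow>
      f \<omega> * sqrt_deriv \<mu> \<kappa> \<omega> = g \<omega> * sqrt_deriv \<nu> \<kappa> \<omega>)"
    by (rule AE_abs_cont_iff[OF d(1) \<rho>])
  also have "\<dots> \<longleftrightarrow> ?R"
  proof
    assume "AE \<omega> in \<rho>. sqrt_deriv \<kappa> \<rho> \<omega> \<noteq> 0 \<longrightarrow>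
      f \<omega> * sqrt_deriv \<mu> \<kappa> \<omega> = g \<omega> * sqrt_deriv \<nu> \<kappa> \<omega>"
    with 1 2 show ?R by eventually_elim auto
  next
    assume ?R
    with 1 2 show "AE \<omega> in \<rho>. sqrt_deriv \<kappa> \<rho> \<omega> \<noteq> 0 \<longrightarrow>
      f \<omega> * sqrt_deriv \<mu> \<kappa> \<omega> = g \<omega> * sqrt_deriv \<nu> \<kappa> \<omega>" by eventually_elim auto
  qed
  finally show ?thesis .
qed

text \<open>Turns the existential choice of a dominating measure into an arbitrary one: the witness
  and the given measure are both compared with a measure above them.\<close>

lemma sigma_rel_iff:
  assumes f: "(f, \<mu>) \<in> sigma_pairs N" and g: "(g, \<nu>) \<in> sigma_pairs N"
    and \<kappa>: "dominates N \<kappa> \<mu> \<nu>"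
  shows "((f, \<mu>), (g, \<nu>)) \<in> sigma_rel N \<longleftrightarrow>
    (AE \<omega> in \<kappa>. f \<omega> * sqrt_deriv \<mu> \<kappa> \<omega> = g \<omega> * sqrt_deriv \<nu> \<kappa> \<omega>)"
proof
  assume "((f, \<mu>), (g, \<nu>)) \<in> sigma_rel N"
  then obtain \<kappa>' where \<kappa>': "dominates N \<kappa>' \<mu> \<nu>"
    and ae: "AE \<omega> in \<kappa>'. f \<omega> * sqrt_deriv \<mu> \<kappa>' \<omega> = g \<omega> * sqrt_deriv \<nu> \<kappa>' \<omega>"
    by (auto simp: sigma_rel_def)
  obtain \<rho> where \<rho>: "\<rho> \<in> finite_word_measures N" "absolutely_continuous \<rho> \<kappa>" "absolutely_continuous \<rho> \<kappa>'"
    using ex_dominating_measure_finite[of "{\<kappa>, \<kappa>'}" N] dominatesD \<kappa> \<kappa>' by auto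
  show "AE \<omega> in \<kappa>. f \<omega> * sqrt_deriv \<mu> \<kappa> \<omega> = g \<omega> * sqrt_deriv \<nu> \<kappa> \<omega>"
    using sigma_rel_dominates_mono[OF f g \<kappa> \<rho>(1,2)] sigma_rel_dominates_mono[OF f g \<kappa>' \<rho>(1,3)] ae
    by simp
qed (use assms in \<open>auto simp: sigma_rel_def\<close>)

text \<open>Transitivity is the point: all three pairs are read over one measure dominating all of
  them, where the relation is equality almost everywhere.\<close>

lemma equiv_sigma_rel: "equiv (sigma_pairs N) (sigma_rel N)"
proof (rule equivI)
  show "sigma_rel N \<subseteq> sigma_pairs N \<times> sigma_pairs N" by (auto simp: sigma_rel_def)
  show "refl_on (sigma_pairs N) (sigma_rel N)"
  proof (rule refl_onI)
    fix u assume u: "u \<in> sigma_pairs N"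
    obtain f \<mu> where fm: "u = (f, \<mu>)" by (cases u)
    have "dominates N \<mu> \<mu> \<mu>"
      using u fm sigma_pairsD(1) by (auto simp: dominates_def absolutely_continuous_def)
    then show "(u, u) \<in> sigma_rel N" using u sigma_rel_iff[of f \<mu> N f \<mu> \<mu>] fm by simp
  qed
  show "sym (sigma_rel N)"
  proof (rule symI)
    fix u v assume uv: "(u, v) \<in> sigma_rel N"
    obtain f \<mu> g \<nu> where e: "u = (f, \<mu>)" "v = (g, \<nu>)" by (cases u, cases v)
    obtain \<kappa> where p: "(f, \<mu>) \<in> sigma_pairs N" "(g, \<nu>) \<in> sigma_pairs N" and d: "dominates N \<kappa> \<mu> \<nu>"
      using uv e by (auto simp: sigma_rel_def)
    have d': "dominates N \<kappa> \<nu> \<mu>" using d by (simp add: dominates_def)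
    show "(v, u) \<in> sigma_rel N"
      using uv unfolding e sigma_rel_iff[OF p d] sigma_rel_iff[OF p(2,1) d'] by eventually_elim simp
  qed
  show "trans (sigma_rel N)"
  proof (rule transI)
    fix u v w assume uv: "(u, v) \<in> sigma_rel N" and vw: "(v, w) \<in> sigma_rel N"
    obtain f \<mu> g \<nu> h \<eta> where e: "u = (f, \<mu>)" "v = (g, \<nu>)" "w = (h, \<eta>)"
      by (cases u, cases v, cases w)
    have p: "(f, \<mu>) \<in> sigma_pairs N" "(g, \<nu>) \<in> sigma_pairs N" "(h, \<eta>) \<in> sigma_pairs N"
      using uv vw e by (auto simp: sigma_rel_def)
    then obtain \<kappa> where "\<kappa> \<in> finite_word_measures N" "absolutely_continuous \<kappa> \<mu>"
        "absolutely_continuous \<kappa> \<nu>" "absolutely_continuous \<kappa> \<eta>"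
      using ex_dominates_pairs[of "{u, v, w}" N] e by auto
    then have d: "dominates N \<kappa> \<mu> \<nu>" "dominates N \<kappa> \<nu> \<eta>" "dominates N \<kappa> \<mu> \<eta>"
      by (auto simp: dominates_def)
    show "(u, w) \<in> sigma_rel N"
      using uv vw unfolding e sigma_rel_iff[OF p(1,2) d(1)] sigma_rel_iff[OF p(2,3) d(2)]
        sigma_rel_iff[OF p(1,3) d(3)] by eventually_elim simp
  qed
qed

lemma sigma_fun_eq_iff:
  assumes "(f, \<mu>) \<in> sigma_pairs N" "(g, \<nu>) \<in> sigma_pairs N"
  shows "sigma_fun N f \<mu> = sigma_fun N g \<nu> \<longleftrightarrow> ((f, \<mu>), (g, \<nu>)) \<in> sigma_rel N"
  unfolding sigma_fun_def by (rule eq_equiv_class_iff[OF equiv_sigma_rel assms])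

lemma mem_sigma_funD:
  assumes "(g, \<nu>) \<in> sigma_fun N f \<mu>"
  shows "(g, \<nu>) \<in> sigma_pairs N" "(f, \<mu>) \<in> sigma_pairs N" "sigma_fun N g \<nu> = sigma_fun N f \<mu>"
proof -
  have r: "((f, \<mu>), (g, \<nu>)) \<in> sigma_rel N" using assms by (simp add: sigma_fun_def)
  then show 1: "(g, \<nu>) \<in> sigma_pairs N" and 2: "(f, \<mu>) \<in> sigma_pairs N" by (auto simp: sigma_rel_def)
  show "sigma_fun N g \<nu> = sigma_fun N f \<mu>" using r sigma_fun_eq_iff[OF 2 1] by simp
qed

lemma mem_sigma_fun_self: "(f, \<mu>) \<in> sigma_pairs N \<Longrightarrow> (f, \<mu>) \<in> sigma_fun N f \<mu>"
  unfolding sigma_fun_def using equiv_class_self[OF equiv_sigma_rel] by blast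

lemma sigma_fun_eqI_AE:
  assumes f: "(f, \<mu>) \<in> sigma_pairs N" and g: "g \<in> borel_measurable (word_borel N)"
    and ae: "AE \<omega> in \<mu>. f \<omega> = g \<omega>"
  shows "(g, \<mu>) \<in> sigma_pairs N" "sigma_fun N f \<mu> = sigma_fun N g \<mu>"
proof -
  note m = sigma_pairsD[OF f]
  have [measurable]: "f \<in> borel_measurable \<mu>" "g \<in> borel_measurable \<mu>"
    using g m measurable_cong_sets[OF finite_word_measuresD(3)[OF m(1)] refl] by auto
  have "integrable \<mu> (\<lambda>\<omega>. (cmod (g \<omega>))\<^sup>2)"
    by (rule integrable_cong_AE_imp[OF m(3)]) (use ae in \<open>measurable, eventually_elim, simp\<close>)
  then show g': "(g, \<mu>) \<in> sigma_pairs N" by (intro sigma_pairsI m g)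
  have d: "dominates N \<mu> \<mu> \<mu>" using m by (simp add: dominates_def absolutely_continuous_def)
  show "sigma_fun N f \<mu> = sigma_fun N g \<mu>"
    unfolding sigma_fun_eq_iff[OF f g'] sigma_rel_iff[OF f g' d] using ae by eventually_elim simp
qed

text \<open>\<open>sqrt_deriv \<kappa> \<kappa>\<close> is 1 almost everywhere, so over a single
  measure classes are those of the usual space of square integrable functions.\<close>

lemma sigma_fun_eq_AE_iff:
  assumes f: "(f, \<kappa>) \<in> sigma_pairs N" and g: "(g, \<kappa>) \<in> sigma_pairs N"
  shows "sigma_fun N f \<kappa> = sigma_fun N g \<kappa> \<longleftrightarrow> (AE \<omega> in \<kappa>. f \<omega> = g \<omega>)"
proof -
  have \<kappa>: "\<kappa> \<in> finite_word_measures N" by (rule sigma_pairsD[OF f])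
  have d: "dominates N \<kappa> \<kappa> \<kappa>" using \<kappa> by (simp add: dominates_def absolutely_continuous_def)
  have "(AE \<omega> in \<kappa>. f \<omega> * sqrt_deriv \<kappa> \<kappa> \<omega> = g \<omega> * sqrt_deriv \<kappa> \<kappa> \<omega>) \<longleftrightarrow> (AE \<omega> in \<kappa>. f \<omega> = g \<omega>)"
    (is "?L \<longleftrightarrow> ?R")
  proof
    assume ?L
    with sqrt_deriv_self[OF \<kappa>] show ?R by eventually_elim simp
  next
    assume ?R
    with sqrt_deriv_self[OF \<kappa>] show ?L by eventually_elim simp
  qed
  then show ?thesis
    unfolding sigma_fun_eq_iff[OF f g] sigma_rel_iff[OF f g d] .
qed

text \<open>The change of representative on which all later computations rest; over
  \<open>\<kappa>\<close> both sides of the defining equation are the same product up to the factor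
  \<open>sqrt_deriv \<kappa> \<kappa>\<close>.\<close>

lemma sigma_fun_dominating:
  assumes f: "(f, \<mu>) \<in> sigma_pairs N" and \<kappa>: "\<kappa> \<in> finite_word_measures N"
    and ac: "absolutely_continuous \<kappa> \<mu>"
  shows "sigma_fun N f \<mu> = sigma_fun N (\<lambda>\<omega>. f \<omega> * sqrt_deriv \<mu> \<kappa> \<omega>) \<kappa>"
proof -
  note g = sigma_pairs_sqrt_deriv[OF f \<kappa> ac]
  have d: "dominates N \<kappa> \<mu> \<kappa>" using \<kappa> ac by (simp add: dominates_def absolutely_continuous_def)
  show ?thesis
    unfolding sigma_fun_eq_iff[OF f g] sigma_rel_iff[OF f g d] 
    using sqrt_deriv_self[OF \<kappa>] by eventually_elim simp
qed

text \<open>Version for a known density \<open>p\<close>: the resulting function is explicit instead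
  of containing a Radon-Nikodym derivative. It serves for indicator functions and for densities of
  push-forwards.\<close>

lemma sigma_fun_density:
  assumes f: "(f, \<mu>) \<in> sigma_pairs N" and \<kappa>: "\<kappa> \<in> finite_word_measures N"
    and p [measurable]: "p \<in> borel_measurable (word_borel N)" and nonneg: "\<And>x. 0 \<le> p x"
    and \<mu>: "\<mu> = density \<kappa> (\<lambda>x. ennreal (p x))"
  shows "(\<lambda>\<omega>. f \<omega> * of_real (sqrt (p \<omega>)), \<kappa>) \<in> sigma_pairs N"
    "sigma_fun N f \<mu> = sigma_fun N (\<lambda>\<omega>. f \<omega> * of_real (sqrt (p \<omega>))) \<kappa>"
proof -
  have s: "sets \<kappa> = sets (word_borel N)" using finite_word_measuresD \<kappa> by blast
  have p': "p \<in> borel_measurable \<kappa>" using p measurable_cong_sets[OF s refl] by blast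
  have ac: "absolutely_continuous \<kappa> \<mu>"
    unfolding \<mu> using p' by (intro absolutely_continuousI_density) auto
  have ae: "AE \<omega> in \<kappa>. sqrt_deriv \<mu> \<kappa> \<omega> = of_real (sqrt (p \<omega>))"
    by (rule sqrt_deriv_density[OF \<kappa> p' nonneg \<mu>])
  note [measurable] = sigma_pairsD(4)[OF f]
  have ae': "AE \<omega> in \<kappa>. f \<omega> * sqrt_deriv \<mu> \<kappa> \<omega> = f \<omega> * of_real (sqrt (p \<omega>))"
    using ae by eventually_elim simp
  have mm: "(\<lambda>\<omega>. f \<omega> * of_real (sqrt (p \<omega>))) \<in> borel_measurable (word_borel N)" by measurable
  note r = sigma_fun_eqI_AE[OF sigma_pairs_sqrt_deriv[OF f \<kappa> ac] mm ae']
  show "(\<lambda>\<omega>. f \<omega> * of_real (sqrt (p \<omega>)), \<kappa>) \<in> sigma_pairs N" by (rule r(1))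
  show "sigma_fun N f \<mu> = sigma_fun N (\<lambda>\<omega>. f \<omega> * of_real (sqrt (p \<omega>))) \<kappa>"
    using r(2) sigma_fun_dominating[OF f \<kappa> ac] by simp
qed

text \<open>Evaluates a definite description over representatives. Independence of the
  representative gives existence; the representative \<open>(f, \<mu>)\<close> itself forces
  uniqueness.\<close>

lemma the_sigma_fun_eq:
  assumes "(f, \<mu>) \<in> sigma_pairs N"
    and "\<And>g \<nu>. (g, \<nu>) \<in> sigma_fun N f \<mu> \<Longrightarrow> F g \<nu> = F f \<mu>"
  shows "(THE z. \<forall>g \<nu>. (g, \<nu>) \<in> sigma_fun N f \<mu> \<longrightarrow> z = F g \<nu>) = F f \<mu>"
proof (rule the_equality)
  fix z assume "\<forall>g \<nu>. (g, \<nu>) \<in> sigma_fun N f \<mu> \<longrightarrow> z = F g \<nu>"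
  then show "z = F f \<mu>" using mem_sigma_fun_self[OF assms(1)] by blast
qed (use assms(2) in auto)

section \<open>Square integrable functions over one measure\<close>

text \<open>Pointwise substitute for the triangle inequality of the square norm; it serves for sums,
  completeness and uniqueness of limits.\<close>

lemma cmod_add_square_le: "(cmod (a + b))\<^sup>2 \<le> 2 * (cmod a)\<^sup>2 + 2 * (cmod b)\<^sup>2"
proof -
  have "(cmod (a + b))\<^sup>2 \<le> (cmod a + cmod b)\<^sup>2"
    by (intro power_mono norm_triangle_ineq) auto
  also have "\<dots> \<le> 2 * (cmod a)\<^sup>2 + 2 * (cmod b)\<^sup>2"
    using sum_squares_bound[of "cmod a" "cmod b"] by (simp add: power2_sum)
  finally show ?thesis .
qed

lemma sigma_pairs_add:
  assumes f: "(f, \<kappa>) \<in> sigma_pairs N" and g: "(g, \<kappa>) \<in> sigma_pairs N"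
  shows "(\<lambda>\<omega>. f \<omega> + g \<omega>, \<kappa>) \<in> sigma_pairs N"
proof (rule sigma_pairsI)
  note [measurable] = sigma_pairsD(2)[OF f] sigma_pairsD(2)[OF g] sigma_pairsD(4)[OF f] sigma_pairsD(4)[OF g]
  show "\<kappa> \<in> finite_word_measures N" by (rule sigma_pairsD[OF f])
  show "(\<lambda>\<omega>. f \<omega> + g \<omega>) \<in> borel_measurable (word_borel N)" by measurable
  show "integrable \<kappa> (\<lambda>\<omega>. (cmod (f \<omega> + g \<omega>))\<^sup>2)"
  proof (rule Bochner_Integration.integrable_bound)
    show "integrable \<kappa> (\<lambda>\<omega>. 2 * (cmod (f \<omega>))\<^sup>2 + 2 * (cmod (g \<omega>))\<^sup>2)"
      using sigma_pairsD(3)[OF f] sigma_pairsD(3)[OF g] by simp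
    show "AE \<omega> in \<kappa>. norm ((cmod (f \<omega> + g \<omega>))\<^sup>2) \<le> norm (2 * (cmod (f \<omega>))\<^sup>2 + 2 * (cmod (g \<omega>))\<^sup>2)"
      by (rule AE_I2) (simp add: cmod_add_square_le)
  qed measurable
qed

lemma sigma_pairs_scale:
  assumes f: "(f, \<kappa>) \<in> sigma_pairs N"
  shows "(\<lambda>\<omega>. c * f \<omega>, \<kappa>) \<in> sigma_pairs N"
proof (rule sigma_pairsI)
  note [measurable] = sigma_pairsD(2,4)[OF f]
  show "\<kappa> \<in> finite_word_measures N" by (rule sigma_pairsD[OF f])
  show "(\<lambda>\<omega>. c * f \<omega>) \<in> borel_measurable (word_borel N)" by measurable
  show "integrable \<kappa> (\<lambda>\<omega>. (cmod (c * f \<omega>))\<^sup>2)"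
    using sigma_pairsD(3)[OF f] by (simp add: norm_mult power_mult_distrib)
qed

lemma sigma_pairs_minus:
  assumes f: "(f, \<kappa>) \<in> sigma_pairs N" and g: "(g, \<kappa>) \<in> sigma_pairs N"
  shows "(\<lambda>\<omega>. f \<omega> - g \<omega>, \<kappa>) \<in> sigma_pairs N"
  using sigma_pairs_add[OF f sigma_pairs_scale[OF g, of "-1"]] by simp

lemma sigma_pairs_indicator:
  assumes f: "(f, \<kappa>) \<in> sigma_pairs N" and A [measurable]: "A \<in> sets (word_borel N)"
  shows "(\<lambda>\<omega>. indicator A \<omega> * f \<omega>, \<kappa>) \<in> sigma_pairs N"
proof (rule sigma_pairsI)
  note [measurable] = sigma_pairsD(2,4)[OF f]
  show \<kappa>: "\<kappa> \<in> finite_word_measures N" by (rule sigma_pairsD[OF f])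
  have [measurable]: "A \<in> sets \<kappa>" using finite_word_measuresD(3)[OF \<kappa>] by simp
  show "(\<lambda>\<omega>. indicator A \<omega> * f \<omega>) \<in> borel_measurable (word_borel N)" by measurable
  show "integrable \<kappa> (\<lambda>\<omega>. (cmod (indicator A \<omega> * f \<omega>))\<^sup>2)"
    by (rule Bochner_Integration.integrable_bound[OF sigma_pairsD(3)[OF f]])
       (auto simp: indicator_def)
qed

lemma sigma_pairs_zero: "\<kappa> \<in> finite_word_measures N \<Longrightarrow> (\<lambda>\<omega>. 0, \<kappa>) \<in> sigma_pairs N"
  by (rule sigma_pairsI) auto

lemma borel_measurable_cnj [measurable]: "cnj \<in> borel_measurable borel"
  by (intro borel_measurable_continuous_onI continuous_intros)

lemma integrable_cnj_mult:
  assumes f: "(f, \<kappa>) \<in> sigma_pairs N" and g: "(g, \<kappa>) \<in> sigma_pairs N"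
  shows "integrable \<kappa> (\<lambda>\<omega>. cnj (f \<omega>) * g \<omega>)"
proof (rule Bochner_Integration.integrable_bound)
  note [measurable] = sigma_pairsD(2)[OF f] sigma_pairsD(2)[OF g]
  show "integrable \<kappa> (\<lambda>\<omega>. (cmod (f \<omega>))\<^sup>2 + (cmod (g \<omega>))\<^sup>2)"
    using sigma_pairsD(3)[OF f] sigma_pairsD(3)[OF g] by simp
  show "AE \<omega> in \<kappa>. norm (cnj (f \<omega>) * g \<omega>) \<le> norm ((cmod (f \<omega>))\<^sup>2 + (cmod (g \<omega>))\<^sup>2)"
  proof (rule AE_I2)
    fix \<omega>
    have "cmod (f \<omega>) * cmod (g \<omega>) \<le> 2 * cmod (f \<omega>) * cmod (g \<omega>)" by simp
    also have "\<dots> \<le> (cmod (f \<omega>))\<^sup>2 + (cmod (g \<omega>))\<^sup>2" by (rule sum_squares_bound)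
    finally show "norm (cnj (f \<omega>) * g \<omega>) \<le> norm ((cmod (f \<omega>))\<^sup>2 + (cmod (g \<omega>))\<^sup>2)"
      by (simp add: norm_mult)
  qed
  show "(\<lambda>\<omega>. cnj (f \<omega>) * g \<omega>) \<in> borel_measurable \<kappa>" by measurable
qed

text \<open>The density is the square of the root, written as a product so that one factor can be
  given to each argument of the inner product.\<close>

lemma integral_sqrt_deriv:
  assumes \<kappa>: "\<kappa> \<in> finite_word_measures N" and \<rho>: "\<rho> \<in> finite_word_measures N"
    and ac: "absolutely_continuous \<rho> \<kappa>" and h: "h \<in> borel_measurable (word_borel N)"
  shows "(LINT \<omega>|\<kappa>. h \<omega>) = (LINT \<omega>|\<rho>. h \<omega> * (sqrt_deriv \<kappa> \<rho> \<omega> * sqrt_deriv \<kappa> \<rho> \<omega>))"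
proof -
  have s: "sets \<rho> = sets (word_borel N)" using finite_word_measuresD \<rho> by blast
  have [measurable]: "h \<in> borel_measurable \<rho>" using h measurable_cong_sets[OF s refl] by blast
  show ?thesis
    by (subst density_sqrt_deriv[OF \<rho> \<kappa> ac], subst integral_density)
      (auto simp: scaleR_conv_of_real sqrt_deriv_mult_self mult.commute)
qed

section \<open>Evaluating the operations on representatives\<close>

text \<open>Two-argument version of \<open>the_sigma_fun_eq\<close>, also quantifying over the
  dominating measure; \<open>\<kappa>\<close> dominating itself shows that the quantification is not
  vacuous.\<close>

lemma the_sigma_fun_pair_eq:
  assumes f: "(f, \<kappa>) \<in> sigma_pairs N" and g: "(g, \<kappa>) \<in> sigma_pairs N"
    and F: "\<And>f' \<mu> g' \<nu> \<kappa>'. (f', \<mu>) \<in> sigma_fun N f \<kappa> \<Longrightarrow> (g', \<nu>) \<in> sigma_fun N g \<kappa> \<Longrightarrow>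
      dominates N \<kappa>' \<mu> \<nu> \<Longrightarrow> F f' \<mu> g' \<nu> \<kappa>' = Z"
  shows "(THE z. \<forall>f' \<mu> g' \<nu> \<kappa>'. (f', \<mu>) \<in> sigma_fun N f \<kappa> \<longrightarrow> (g', \<nu>) \<in> sigma_fun N g \<kappa> \<longrightarrow>
      dominates N \<kappa>' \<mu> \<nu> \<longrightarrow> z = F f' \<mu> g' \<nu> \<kappa>') = Z"
proof (rule the_equality)
  have d: "dominates N \<kappa> \<kappa> \<kappa>"
    using sigma_pairsD(1)[OF f] by (simp add: dominates_def absolutely_continuous_def)
  fix z
  assume "\<forall>f' \<mu> g' \<nu> \<kappa>'. (f', \<mu>) \<in> sigma_fun N f \<kappa> \<longrightarrow> (g', \<nu>) \<in> sigma_fun N g \<kappa> \<longrightarrow>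
      dominates N \<kappa>' \<mu> \<nu> \<longrightarrow> z = F f' \<mu> g' \<nu> \<kappa>'"
  with mem_sigma_fun_self[OF f] mem_sigma_fun_self[OF g] d have "z = F f \<kappa> g \<kappa> \<kappa>" by blast
  with F[OF mem_sigma_fun_self[OF f] mem_sigma_fun_self[OF g] d] show "z = Z" by simp
qed (use F in blast)

text \<open>\<open>\<kappa>'\<close> dominates \<open>\<mu>\<close> but may be unrelated to
  \<open>\<kappa>\<close>. Over \<open>\<rho>\<close> the chain rule merges the two roots on the
  left into \<open>sqrt_deriv \<mu> \<rho>\<close>, and the claim becomes the relation between the
  representatives.\<close>

lemma mem_sigma_fun_common:
  assumes f: "(f', \<mu>) \<in> sigma_fun N f \<kappa>" and ac: "absolutely_continuous \<kappa>' \<mu>"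
    and \<kappa>': "\<kappa>' \<in> finite_word_measures N"
    and \<rho>: "\<rho> \<in> finite_word_measures N" "absolutely_continuous \<rho> \<kappa>" "absolutely_continuous \<rho> \<kappa>'"
  shows "AE \<omega> in \<rho>. f' \<omega> * sqrt_deriv \<mu> \<kappa>' \<omega> * sqrt_deriv \<kappa>' \<rho> \<omega> = f \<omega> * sqrt_deriv \<kappa> \<rho> \<omega>"
proof -
  note m = mem_sigma_funD[OF f]
  have \<rho>\<mu>: "absolutely_continuous \<rho> \<mu>" using absolutely_continuous_trans ac \<rho> by blast
  have d: "dominates N \<rho> \<mu> \<kappa>" using \<rho> \<rho>\<mu> by (simp add: dominates_def)
  have "AE \<omega> in \<rho>. f' \<omega> * sqrt_deriv \<mu> \<rho> \<omega> = f \<omega> * sqrt_deriv \<kappa> \<rho> \<omega>"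
    using m(3) unfolding sigma_fun_eq_iff[OF m(1,2)] sigma_rel_iff[OF m(1,2) d] .
  then show ?thesis
    using sqrt_deriv_chain[OF sigma_pairsD(1)[OF m(1)] \<kappa>' \<rho>(1) ac \<rho>(3)]
    by eventually_elim (simp add: mult.assoc)
qed

lemma sigma_add_sigma_fun:
  assumes f: "(f, \<kappa>) \<in> sigma_pairs N" and g: "(g, \<kappa>) \<in> sigma_pairs N"
  shows "sigma_add N (sigma_fun N f \<kappa>) (sigma_fun N g \<kappa>) = sigma_fun N (\<lambda>\<omega>. f \<omega> + g \<omega>) \<kappa>"
  unfolding sigma_add_def
proof (rule the_sigma_fun_pair_eq[OF f g])
  fix f' \<mu> g' \<nu> \<kappa>'
  assume f': "(f', \<mu>) \<in> sigma_fun N f \<kappa>" and g': "(g', \<nu>) \<in> sigma_fun N g \<kappa>"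
    and d: "dominates N \<kappa>' \<mu> \<nu>"
  note dd = dominatesD[OF d]
  have \<kappa>: "\<kappa> \<in> finite_word_measures N" by (rule sigma_pairsD[OF f])
  obtain \<rho> where \<rho>: "\<rho> \<in> finite_word_measures N" "absolutely_continuous \<rho> \<kappa>" "absolutely_continuous \<rho> \<kappa>'"
    using ex_dominating_measure_finite[of "{\<kappa>, \<kappa>'}" N] dd \<kappa> by auto
  note p1 = sigma_pairs_add[OF sigma_pairs_sqrt_deriv[OF mem_sigma_funD(1)[OF f'] dd(1,2)]
      sigma_pairs_sqrt_deriv[OF mem_sigma_funD(1)[OF g'] dd(1,3)]]
  note p2 = sigma_pairs_add[OF f g]
  show "sigma_fun N (\<lambda>\<omega>. f' \<omega> * sqrt_deriv \<mu> \<kappa>' \<omega> + g' \<omega> * sqrt_deriv \<nu> \<kappa>' \<omega>) \<kappa>' =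
    sigma_fun N (\<lambda>\<omega>. f \<omega> + g \<omega>) \<kappa>"
    unfolding sigma_fun_dominating[OF p1 \<rho>(1,3)] sigma_fun_dominating[OF p2 \<rho>(1,2)]
      sigma_fun_eq_AE_iff[OF sigma_pairs_sqrt_deriv[OF p1 \<rho>(1,3)] sigma_pairs_sqrt_deriv[OF p2 \<rho>(1,2)]]
    using mem_sigma_fun_common[OF f' dd(2,1) \<rho>] mem_sigma_fun_common[OF g' dd(3,1) \<rho>]
    by eventually_elim (simp add: algebra_simps)
qed

lemma sigma_inner_sigma_fun:
  assumes f: "(f, \<kappa>) \<in> sigma_pairs N" and g: "(g, \<kappa>) \<in> sigma_pairs N"
  shows "sigma_inner N (sigma_fun N f \<kappa>) (sigma_fun N g \<kappa>) = (LINT \<omega>|\<kappa>. cnj (f \<omega>) * g \<omega>)"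
  unfolding sigma_inner_def
proof (rule the_sigma_fun_pair_eq[OF f g])
  fix f' \<mu> g' \<nu> \<kappa>'
  assume f': "(f', \<mu>) \<in> sigma_fun N f \<kappa>" and g': "(g', \<nu>) \<in> sigma_fun N g \<kappa>"
    and d: "dominates N \<kappa>' \<mu> \<nu>"
  note dd = dominatesD[OF d]
  have \<kappa>: "\<kappa> \<in> finite_word_measures N" by (rule sigma_pairsD[OF f])
  obtain \<rho> where \<rho>: "\<rho> \<in> finite_word_measures N" "absolutely_continuous \<rho> \<kappa>" "absolutely_continuous \<rho> \<kappa>'"
    using ex_dominating_measure_finite[of "{\<kappa>, \<kappa>'}" N] dd \<kappa> by auto
  note [measurable] = sigma_pairsD(4)[OF f] sigma_pairsD(4)[OF g] sigma_pairsD(4)[OF mem_sigma_funD(1)[OF f']]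
    sigma_pairsD(4)[OF mem_sigma_funD(1)[OF g']] sqrt_deriv_measurable_word_borel[OF dd(1)] sqrt_deriv_measurable_word_borel[OF \<rho>(1)]
  have meas: "h \<in> borel_measurable (word_borel N) \<Longrightarrow> h \<in> borel_measurable \<rho>" for h :: "_ \<Rightarrow> complex"
    using measurable_cong_sets[OF finite_word_measuresD(3)[OF \<rho>(1)] refl] by blast
  show "(LINT \<omega>|\<kappa>'. cnj (f' \<omega>) * g' \<omega> * sqrt_deriv \<mu> \<kappa>' \<omega> * sqrt_deriv \<nu> \<kappa>' \<omega>) =
    (LINT \<omega>|\<kappa>. cnj (f \<omega>) * g \<omega>)"
  proof (subst integral_sqrt_deriv[OF dd(1) \<rho>(1,3)], measurable, 
         subst integral_sqrt_deriv[OF \<kappa> \<rho>(1,2)], measurable, rule integral_cong_AE)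
    show "AE \<omega> in \<rho>. cnj (f' \<omega>) * g' \<omega> * sqrt_deriv \<mu> \<kappa>' \<omega> * sqrt_deriv \<nu> \<kappa>' \<omega> *
         (sqrt_deriv \<kappa>' \<rho> \<omega> * sqrt_deriv \<kappa>' \<rho> \<omega>) =
        cnj (f \<omega>) * g \<omega> * (sqrt_deriv \<kappa> \<rho> \<omega> * sqrt_deriv \<kappa> \<rho> \<omega>)"
      using mem_sigma_fun_common[OF f' dd(2,1) \<rho>] mem_sigma_fun_common[OF g' dd(3,1) \<rho>]
    proof eventually_elim
      case (elim \<omega>)
      \<comment> \<open>The roots are real, so conjugation passes over them and each argument can be
        grouped with its own roots before the common representatives are substituted.\<close>
      have "cnj (f' \<omega> * sqrt_deriv \<mu> \<kappa>' \<omega> * sqrt_deriv \<kappa>' \<rho> \<omega>) * (g' \<omega> * sqrt_deriv \<nu> \<kappa>' \<omega> * sqrt_deriv \<kappa>' \<rho> \<omega>)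
        = cnj (f \<omega> * sqrt_deriv \<kappa> \<rho> \<omega>) * (g \<omega> * sqrt_deriv \<kappa> \<rho> \<omega>)"
        by (simp only: elim)
      then show ?case by (simp add: mult_ac)
    qed
  qed (intro meas; measurable)+
qed

lemma sigma_scale_sigma_fun:
  assumes f: "(f, \<mu>) \<in> sigma_pairs N"
  shows "sigma_scale N c (sigma_fun N f \<mu>) = sigma_fun N (\<lambda>\<omega>. c * f \<omega>) \<mu>"
  unfolding sigma_scale_def
proof (rule the_sigma_fun_eq[OF f, where F = "\<lambda>f \<mu>. sigma_fun N (\<lambda>\<omega>. c * f \<omega>) \<mu>"])
  fix g \<nu> assume g: "(g, \<nu>) \<in> sigma_fun N f \<mu>"
  note m = mem_sigma_funD[OF g]
  obtain \<kappa> where d: "dominates N \<kappa> \<nu> \<mu>"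
    using ex_dominating_measure_finite[of "{\<nu>, \<mu>}" N] sigma_pairsD(1)[OF m(1)] sigma_pairsD(1)[OF m(2)] 
    by (auto simp: dominates_def)
  have "AE \<omega> in \<kappa>. g \<omega> * sqrt_deriv \<nu> \<kappa> \<omega> = f \<omega> * sqrt_deriv \<mu> \<kappa> \<omega>"
    using m(3) unfolding sigma_fun_eq_iff[OF m(1,2)] sigma_rel_iff[OF m(1,2) d] .
  then show "sigma_fun N (\<lambda>\<omega>. c * g \<omega>) \<nu> = sigma_fun N (\<lambda>\<omega>. c * f \<omega>) \<mu>"
    unfolding sigma_fun_eq_iff[OF sigma_pairs_scale[OF m(1)] sigma_pairs_scale[OF m(2)]]
      sigma_rel_iff[OF sigma_pairs_scale[OF m(1)] sigma_pairs_scale[OF m(2)] d]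
    by eventually_elim (simp add: mult.assoc)
qed

section \<open>Completeness\<close>

text \<open>Riesz-Fischer argument: increments along a fast subsequence have summable integrals, so
  the subsequence converges almost everywhere, and Fatou's lemma carries the Cauchy estimate of the
  full sequence over to the limit.\<close>

lemma square_integrable_complete:
  fixes h :: "nat \<Rightarrow> 'a \<Rightarrow> complex"
  assumes fin: "finite_measure M" and meas [measurable]: "\<And>n. h n \<in> borel_measurable M"
    and int: "\<And>n. integrable M (\<lambda>x. (cmod (h n x))\<^sup>2)"
    and cauchy: "\<And>e. 0 < e \<Longrightarrow> \<exists>K. \<forall>m\<ge>K. \<forall>n\<ge>K. (LINT x|M. (cmod (h m x - h n x))\<^sup>2) < e"
  shows "\<exists>g\<in>borel_measurable M. integrable M (\<lambda>x. (cmod (g x))\<^sup>2) \<and>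
    (\<lambda>n. LINT x|M. (cmod (h n x - g x))\<^sup>2) \<longlonglongrightarrow> 0"
proof -
  interpret finite_measure M by fact
  have intd: "integrable M (\<lambda>x. (cmod (h m x - h n x))\<^sup>2)" for m n
    by (rule Bochner_Integration.integrable_bound[where f = "\<lambda>x. 2 * (cmod (h m x))\<^sup>2 + 2 * (cmod (h n x))\<^sup>2"])
      (use int cmod_add_square_le[of "h m x" "- h n x" for x] in auto)
  have nn: "(\<integral>\<^sup>+x. ennreal ((cmod (h m x - h n x))\<^sup>2) \<partial>M) = ennreal (LINT x|M. (cmod (h m x - h n x))\<^sup>2)" for m n
    by (rule nn_integral_eq_integral[OF intd]) auto
  have "\<exists>K. \<forall>m\<ge>K. \<forall>n\<ge>K. (LINT x|M. (cmod (h m x - h n x))\<^sup>2) < (1/4)^j" for j :: nat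
    by (rule cauchy) simp
  then obtain K where K: "\<And>j m n. m \<ge> K j \<Longrightarrow> n \<ge> K j \<Longrightarrow> (LINT x|M. (cmod (h m x - h n x))\<^sup>2) < (1/4)^j"
    by metis
  \<comment> \<open>The sum puts \<open>r j\<close> and \<open>r (Suc j)\<close> above
    \<open>K j\<close>; the extra \<open>j\<close> gives \<open>r i \<ge> i\<close>, which later
    places the subsequence beyond any fixed \<open>K j\<close>.\<close>
  define r where "r j = (\<Sum>i\<le>j. K i) + j" for j
  have rK: "r j \<ge> K j" for j
    unfolding r_def by (rule trans_le_add1) (rule member_le_sum; simp)
  have rS: "r (Suc j) \<ge> K j" for j
    unfolding r_def by (rule trans_le_add1) (rule member_le_sum; simp)
  define d where "d j x = cmod (h (r (Suc j)) x - h (r j) x)" for j x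
  have [measurable]: "d j \<in> borel_measurable M" for j unfolding d_def by measurable
  \<comment> \<open>The arithmetic-geometric mean inequality replaces Cauchy-Schwarz in passing from L2 to L1.\<close>
  have L1: "(\<integral>\<^sup>+x. ennreal (d j x) \<partial>M) \<le> ennreal ((1/2)^j * (1 + measure M (space M)))" for j
  proof -
    \<comment> \<open>The weight \<open>2^j\<close> balances the two terms: with a square integral
      below \<open>(1/4)^j\<close>, each contributes a multiple of \<open>(1/2)^j\<close>.\<close>
    have "d j x \<le> 2^j * (d j x)\<^sup>2 + (1/2)^j" for x
    proof -
      have "t \<le> t\<^sup>2 + 1" if "0 \<le> t" for t :: real
        using sum_squares_bound[of t 1] that by simp
      then have "2^j * d j x \<le> (2^j * d j x)\<^sup>2 + 1" by (simp add: d_def)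
      then have "(1/2)^j * (2^j * d j x) \<le> (1/2)^j * ((2^j * d j x)\<^sup>2 + 1)"
        by (intro mult_left_mono) auto
      then show ?thesis by (simp add: algebra_simps power2_eq_square flip: power_mult_distrib)
    qed
    then have "(\<integral>\<^sup>+x. ennreal (d j x) \<partial>M) \<le> (\<integral>\<^sup>+x. ennreal (2^j) * ennreal ((d j x)\<^sup>2) + ennreal ((1/2)^j) \<partial>M)"
      by (intro nn_integral_mono) (simp flip: ennreal_mult ennreal_plus)
    also have "\<dots> = ennreal (2^j) * (\<integral>\<^sup>+x. ennreal ((d j x)\<^sup>2) \<partial>M) + ennreal ((1/2)^j) * emeasure M (space M)"
      by (simp add: nn_integral_add nn_integral_cmult)
    also have "\<dots> \<le> ennreal (2^j) * ennreal ((1/4)^j) + ennreal ((1/2)^j) * emeasure M (space M)"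
      unfolding d_def nn using K[OF rS rK, of j]
      by (intro add_mono mult_left_mono order_refl ennreal_leI) auto
    also have "\<dots> = ennreal ((1/2)^j * (1 + measure M (space M)))"
      by (simp add: emeasure_eq_measure distrib_left flip: ennreal_mult ennreal_plus power_mult_distrib)
    finally show ?thesis .
  qed
  have "(\<integral>\<^sup>+x. (\<Sum>j. ennreal (d j x)) \<partial>M) = (\<Sum>j. \<integral>\<^sup>+x. ennreal (d j x) \<partial>M)"
    by (rule nn_integral_suminf) auto
  also have "\<dots> \<le> (\<Sum>j. ennreal ((1/2)^j * (1 + measure M (space M))))"
    by (intro suminf_le L1) auto
  also have "\<dots> = ennreal (\<Sum>j. (1/2)^j * (1 + measure M (space M)))"
    by (rule suminf_ennreal2) (auto intro!: summable_mult2 summable_geometric)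
  also have "\<dots> < \<infinity>" by simp
  finally have "AE x in M. (\<Sum>j. ennreal (d j x)) \<noteq> \<infinity>"
    by (intro nn_integral_PInf_AE) auto
  then have conv: "AE x in M. convergent (\<lambda>j. h (r j) x)"
  proof eventually_elim
    case (elim x)
    have "summable (\<lambda>j. d j x)"
      by (rule summable_suminf_not_top) (use elim in \<open>auto simp: d_def\<close>)
    then have "summable (\<lambda>j. h (r (Suc j)) x - h (r j) x)"
      unfolding d_def by (rule summable_norm_cancel)
    then obtain s where "(\<lambda>n. \<Sum>j<n. h (r (Suc j)) x - h (r j) x) \<longlonglongrightarrow> s"
      unfolding summable_def sums_def by auto
    then have "(\<lambda>n. (h (r n) x - h (r 0) x) + h (r 0) x) \<longlonglongrightarrow> s + h (r 0) x"
      unfolding sum_lessThan_telescope[of "\<lambda>j. h (r j) x"] by (intro tendsto_add tendsto_const)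
    then show ?case by (auto simp: convergent_def)
  qed
  \<comment> \<open>Where the subsequence diverges the value of \<open>lim\<close> is irrelevant, as
    this happens only on a null set; measurability nevertheless holds everywhere.\<close>
  define g where "g x = lim (\<lambda>j. h (r j) x)" for x
  have [measurable]: "g \<in> borel_measurable M"
    unfolding g_def by (rule borel_measurable_lim_metric) measurable
  have bound: "(\<integral>\<^sup>+x. ennreal ((cmod (h n x - g x))\<^sup>2) \<partial>M) \<le> ennreal ((1/4)^j)" if n: "n \<ge> K j" for n j
  proof -
    \<comment> \<open>Writing the integrand as a limit inferior along the subsequence prepares for
      Fatou's lemma; \<open>n\<close> stays fixed.\<close>
    have "(\<integral>\<^sup>+x. ennreal ((cmod (h n x - g x))\<^sup>2) \<partial>M) =
        (\<integral>\<^sup>+x. liminf (\<lambda>i. ennreal ((cmod (h n x - h (r i) x))\<^sup>2)) \<partial>M)"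
    proof (rule nn_integral_cong_AE, use conv in eventually_elim)
      case (elim x)
      then have "(\<lambda>i. h (r i) x) \<longlonglongrightarrow> g x" unfolding g_def by (simp add: convergent_LIMSEQ_iff)
      then have "(\<lambda>i. ennreal ((cmod (h n x - h (r i) x))\<^sup>2)) \<longlonglongrightarrow> ennreal ((cmod (h n x - g x))\<^sup>2)"
        by (intro tendsto_ennrealI tendsto_intros)
      from lim_imp_Liminf[OF trivial_limit_sequentially this] show ?case by (rule sym)
    qed
    also have "\<dots> \<le> liminf (\<lambda>i. \<integral>\<^sup>+x. ennreal ((cmod (h n x - h (r i) x))\<^sup>2) \<partial>M)"
      by (rule nn_integral_liminf) auto
    also have "\<dots> \<le> limsup (\<lambda>i. \<integral>\<^sup>+x. ennreal ((cmod (h n x - h (r i) x))\<^sup>2) \<partial>M)"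
      by (rule Liminf_le_Limsup) simp
    also have "\<dots> \<le> ennreal ((1/4)^j)"
    proof (rule Limsup_bounded, rule eventually_sequentiallyI)
      fix i assume "i \<ge> K j"
      then have "r i \<ge> K j" by (simp add: r_def)
      then show "(\<integral>\<^sup>+x. ennreal ((cmod (h n x - h (r i) x))\<^sup>2) \<partial>M) \<le> ennreal ((1/4)^j)"
        unfolding nn using K[OF n] by (intro ennreal_leI) (simp add: less_imp_le)
    qed
    finally show ?thesis .
  qed
  have intg: "integrable M (\<lambda>x. (cmod (h n x - g x))\<^sup>2)" if "n \<ge> K j" for n j
    by (rule integrableI_bounded) (use bound[OF that] in \<open>auto simp: le_less_trans\<close>)
  have "integrable M (\<lambda>x. (cmod (g x))\<^sup>2)"
  proof (rule Bochner_Integration.integrable_bound)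
    \<comment> \<open>One index suffices: \<open>g\<close> is \<open>h (K 0)\<close> plus a
      difference already known to be square integrable.\<close>
    show "integrable M (\<lambda>x. 2 * (cmod (h (K 0) x))\<^sup>2 + 2 * (cmod (h (K 0) x - g x))\<^sup>2)"
      using int intg[of 0 "K 0"] by simp
    show "AE x in M. norm ((cmod (g x))\<^sup>2) \<le> norm (2 * (cmod (h (K 0) x))\<^sup>2 + 2 * (cmod (h (K 0) x - g x))\<^sup>2)"
    proof (rule AE_I2)
      fix x
      show "norm ((cmod (g x))\<^sup>2) \<le> norm (2 * (cmod (h (K 0) x))\<^sup>2 + 2 * (cmod (h (K 0) x - g x))\<^sup>2)"
        using cmod_add_square_le[of "h (K 0) x" "g x - h (K 0) x"] by (simp add: norm_minus_commute)
    qed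
  qed auto
  moreover have "(\<lambda>n. LINT x|M. (cmod (h n x - g x))\<^sup>2) \<longlonglongrightarrow> 0"
  proof (rule LIMSEQ_I)
    fix e :: real assume "0 < e"
    then obtain j :: nat where j: "(1/4)^j < e" using real_arch_pow_inv[of e "1/4"] by auto
    show "\<exists>no. \<forall>n\<ge>no. norm ((LINT x|M. (cmod (h n x - g x))\<^sup>2) - 0) < e"
    proof (intro exI allI impI)
      fix n assume n: "n \<ge> K j"
      have "ennreal (LINT x|M. (cmod (h n x - g x))\<^sup>2) \<le> ennreal ((1/4)^j)"
        using bound[OF n] nn_integral_eq_integral[OF intg[OF n]] by simp
      then have "(LINT x|M. (cmod (h n x - g x))\<^sup>2) \<le> (1/4)^j" by simp
      with j show "norm ((LINT x|M. (cmod (h n x - g x))\<^sup>2) - 0) < e" by simp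
    qed
  qed
  ultimately show ?thesis by auto
qed

section \<open>The Hilbert space structure\<close>

lemma sigma_space_simps [simp]:
  "carrier (sigma_space N) = sigma_pairs N // sigma_rel N"
  "\<zero>\<^bsub>sigma_space N\<^esub> = sigma_fun N (\<lambda>_. 0) (null_measure (word_borel N))"
  "u \<oplus>\<^bsub>sigma_space N\<^esub> v = sigma_add N u v"
  "c \<odot>\<^bsub>sigma_space N\<^esub> u = sigma_scale N c u"
  "hinner (sigma_space N) u v = sigma_inner N u v"
  by (simp_all add: sigma_space_def)

lemma sigma_fun_carrier: "(f, \<mu>) \<in> sigma_pairs N \<Longrightarrow> sigma_fun N f \<mu> \<in> sigma_pairs N // sigma_rel N"
  unfolding sigma_fun_def by (rule quotientI)

lemma sigma_carrierE:
  assumes "u \<in> sigma_pairs N // sigma_rel N"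
  obtains f \<mu> where "(f, \<mu>) \<in> sigma_pairs N" "u = sigma_fun N f \<mu>"
  using assms unfolding sigma_fun_def by (auto elim!: quotientE)

lemma sigma_sequenceE:
  assumes "\<And>n :: nat. u n \<in> sigma_pairs N // sigma_rel N"
  obtains \<kappa> h where "\<kappa> \<in> finite_word_measures N" "\<And>n. (h n, \<kappa>) \<in> sigma_pairs N"
    "\<And>n. u n = sigma_fun N (h n) \<kappa>"
proof -
  have "\<forall>n. \<exists>f \<mu>. (f, \<mu>) \<in> sigma_pairs N \<and> u n = sigma_fun N f \<mu>"
    using assms by (metis sigma_carrierE)
  then obtain f m where fm: "\<And>n. (f n, m n) \<in> sigma_pairs N" "\<And>n. u n = sigma_fun N (f n) (m n)"
    by metis
  obtain \<kappa> where \<kappa>: "\<kappa> \<in> finite_word_measures N" "\<And>n. absolutely_continuous \<kappa> (m n)"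
    using ex_dominating_measure[of m N] sigma_pairsD(1)[OF fm(1)] by blast
  show ?thesis
    by (rule that[of \<kappa> "\<lambda>n \<omega>. f n \<omega> * sqrt_deriv (m n) \<kappa> \<omega>"])
      (use \<kappa> fm sigma_pairs_sqrt_deriv sigma_fun_dominating in auto)
qed

lemma sigma_tripleE:
  assumes "u \<in> sigma_pairs N // sigma_rel N" "v \<in> sigma_pairs N // sigma_rel N"
    "w \<in> sigma_pairs N // sigma_rel N"
  obtains \<kappa> f g h where "\<kappa> \<in> finite_word_measures N"
    "(f, \<kappa>) \<in> sigma_pairs N" "u = sigma_fun N f \<kappa>"
    "(g, \<kappa>) \<in> sigma_pairs N" "v = sigma_fun N g \<kappa>"
    "(h, \<kappa>) \<in> sigma_pairs N" "w = sigma_fun N h \<kappa>"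
proof -
  \<comment> \<open>The triple is extended to a constant tail, so that the choice of one measure for
    a sequence covers it.\<close>
  define s where "s n = (if n = 0 then u else if n = 1 then v else w)" for n :: nat
  have "s n \<in> sigma_pairs N // sigma_rel N" for n using assms by (simp add: s_def)
  then obtain \<kappa> h where h: "\<kappa> \<in> finite_word_measures N" "\<And>n. (h n, \<kappa>) \<in> sigma_pairs N"
    "\<And>n. s n = sigma_fun N (h n) \<kappa>" using sigma_sequenceE[of s N] by blast
  show ?thesis
    by (rule that[of \<kappa> "h 0" "h 1" "h 2"])
      (use h h(3)[of 0] h(3)[of 1] h(3)[of 2] in \<open>auto simp: s_def\<close>)
qed

lemma sigma_pairE:
  assumes "u \<in> sigma_pairs N // sigma_rel N" "v \<in> sigma_pairs N // sigma_rel N"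
  obtains \<kappa> f g where "(f, \<kappa>) \<in> sigma_pairs N" "u = sigma_fun N f \<kappa>"
    "(g, \<kappa>) \<in> sigma_pairs N" "v = sigma_fun N g \<kappa>"
  by (rule sigma_tripleE[OF assms assms(2)]) (rule that)

lemma null_measure_finite_word_measure: "null_measure (word_borel N) \<in> finite_word_measures N"
  by (simp add: finite_word_measures_def finite_measureI)

text \<open>The null measure lies below every measure, so the zero vector can be represented over
  whichever \<open>\<kappa>\<close> is in use.\<close>

lemma sigma_zero_eq:
  assumes "\<kappa> \<in> finite_word_measures N"
  shows "sigma_fun N (\<lambda>_. 0) (null_measure (word_borel N)) = sigma_fun N (\<lambda>_. 0) \<kappa>"
proof -
  have ac: "absolutely_continuous \<kappa> (null_measure (word_borel N))"
    using finite_word_measuresD(3)[OF assms]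
    by (auto simp: absolutely_continuous_def null_sets_def)
  show ?thesis
    using sigma_fun_dominating[OF sigma_pairs_zero[OF null_measure_finite_word_measure] assms ac] by simp
qed

lemma sigma_zero_carrier:
  "sigma_fun N (\<lambda>_. 0) (null_measure (word_borel N)) \<in> sigma_pairs N // sigma_rel N"
  by (intro sigma_fun_carrier sigma_pairs_zero null_measure_finite_word_measure)

lemma sigma_add_carrier:
  assumes "u \<in> sigma_pairs N // sigma_rel N" "v \<in> sigma_pairs N // sigma_rel N"
  shows "sigma_add N u v \<in> sigma_pairs N // sigma_rel N"
  by (rule sigma_pairE[OF assms]) (auto simp: sigma_add_sigma_fun intro!: sigma_fun_carrier sigma_pairs_add)

lemma sigma_scale_carrier:
  assumes "u \<in> sigma_pairs N // sigma_rel N"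
  shows "sigma_scale N c u \<in> sigma_pairs N // sigma_rel N"
  using assms by (auto elim!: sigma_carrierE simp: sigma_scale_sigma_fun intro!: sigma_fun_carrier sigma_pairs_scale)

lemma abelian_group_sigma_space: "abelian_group (sigma_space N)"
proof (rule abelian_groupI; unfold sigma_space_simps)
  fix x y z assume "x \<in> sigma_pairs N // sigma_rel N" "y \<in> sigma_pairs N // sigma_rel N"
    "z \<in> sigma_pairs N // sigma_rel N"
  then show "sigma_add N (sigma_add N x y) z = sigma_add N x (sigma_add N y z)"
    by (rule sigma_tripleE) (simp add: sigma_add_sigma_fun sigma_pairs_add add.assoc)
next
  fix x y assume x: "x \<in> sigma_pairs N // sigma_rel N" and y: "y \<in> sigma_pairs N // sigma_rel N"
  show "sigma_add N x y = sigma_add N y x"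
    by (rule sigma_pairE[OF x y]) (simp add: sigma_add_sigma_fun add.commute)
next
  fix x assume x: "x \<in> sigma_pairs N // sigma_rel N"
  then show "sigma_add N (sigma_fun N (\<lambda>_. 0) (null_measure (word_borel N))) x = x"
    by (rule sigma_carrierE)
      (simp add: sigma_zero_eq[OF sigma_pairsD(1)] sigma_add_sigma_fun sigma_pairs_zero sigma_pairsD(1))
  from x obtain f \<mu> where f: "(f, \<mu>) \<in> sigma_pairs N" "x = sigma_fun N f \<mu>" by (rule sigma_carrierE)
  have f': "(\<lambda>\<omega>. - f \<omega>, \<mu>) \<in> sigma_pairs N" using sigma_pairs_scale[OF f(1), of "-1"] by simp
  show "\<exists>y\<in>sigma_pairs N // sigma_rel N.
      sigma_add N y x = sigma_fun N (\<lambda>_. 0) (null_measure (word_borel N))"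
    by (rule bexI[of _ "sigma_fun N (\<lambda>\<omega>. - f \<omega>) \<mu>"])
      (use f f' in \<open>auto simp: sigma_add_sigma_fun sigma_zero_eq[OF sigma_pairsD(1)] sigma_fun_carrier\<close>)
qed (use sigma_zero_carrier sigma_add_carrier in auto)

lemma sigma_minus_sigma_fun:
  assumes f: "(f, \<kappa>) \<in> sigma_pairs N" and g: "(g, \<kappa>) \<in> sigma_pairs N"
  shows "sigma_fun N f \<kappa> \<ominus>\<^bsub>sigma_space N\<^esub> sigma_fun N g \<kappa> = sigma_fun N (\<lambda>\<omega>. f \<omega> - g \<omega>) \<kappa>"
proof -
  interpret abelian_group "sigma_space N" by (rule abelian_group_sigma_space)
  have g': "(\<lambda>\<omega>. - g \<omega>, \<kappa>) \<in> sigma_pairs N" using sigma_pairs_scale[OF g, of "-1"] by simp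
  have "\<ominus>\<^bsub>sigma_space N\<^esub> sigma_fun N g \<kappa> = sigma_fun N (\<lambda>\<omega>. - g \<omega>) \<kappa>"
    by (rule minus_equality)
      (use g g' in \<open>auto simp: sigma_add_sigma_fun sigma_zero_eq[OF sigma_pairsD(1)[OF g]] sigma_fun_carrier\<close>)
  then show ?thesis using f g' by (simp add: a_minus_def sigma_add_sigma_fun)
qed

lemma sigma_inner_self:
  assumes f: "(f, \<kappa>) \<in> sigma_pairs N"
  shows "sigma_inner N (sigma_fun N f \<kappa>) (sigma_fun N f \<kappa>) = of_real (LINT \<omega>|\<kappa>. (cmod (f \<omega>))\<^sup>2)"
proof -
  have "cnj (f \<omega>) * f \<omega> = of_real ((cmod (f \<omega>))\<^sup>2)" for \<omega>
    by (metis complex_norm_square mult.commute)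
  then show ?thesis
    unfolding sigma_inner_sigma_fun[OF f f] by (simp only: integral_complex_of_real)
qed

lemma hnorm_sigma_fun:
  assumes f: "(f, \<kappa>) \<in> sigma_pairs N"
  shows "hnorm (sigma_space N) (sigma_fun N f \<kappa>) = sqrt (LINT \<omega>|\<kappa>. (cmod (f \<omega>))\<^sup>2)"
  by (simp add: hnorm_def sigma_inner_self[OF f])

lemma hilbert_space_sigma_space: "complex_hilbert_space (sigma_space N)"
proof -
  let ?R = "ring_of_type_algebra :: complex ring"
  have "Module.module ?R (sigma_space N)"
  proof (rule moduleI; (unfold sigma_space_simps)?)
    show "cring ?R" by (rule cring_from_type_algebra)
    show "abelian_group (sigma_space N)" by (rule abelian_group_sigma_space)
  next
    fix a b x y assume "x \<in> sigma_pairs N // sigma_rel N" "y \<in> sigma_pairs N // sigma_rel N"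
    then obtain \<kappa> f g where f: "(f, \<kappa>) \<in> sigma_pairs N" "x = sigma_fun N f \<kappa>"
      and g: "(g, \<kappa>) \<in> sigma_pairs N" "y = sigma_fun N g \<kappa>" by (rule sigma_pairE)
    show "sigma_scale N a (sigma_add N x y) = sigma_add N (sigma_scale N a x) (sigma_scale N a y)"
      using f g by (simp add: sigma_scale_sigma_fun sigma_add_sigma_fun sigma_pairs_add sigma_pairs_scale distrib_left)
  next
    fix a b x assume "x \<in> sigma_pairs N // sigma_rel N"
    then obtain \<kappa> f where f: "(f, \<kappa>) \<in> sigma_pairs N" "x = sigma_fun N f \<kappa>" by (rule sigma_carrierE)
    show "sigma_scale N (a \<oplus>\<^bsub>?R\<^esub> b) x = sigma_add N (sigma_scale N a x) (sigma_scale N b x)"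
      using f by (simp add: ring_of_type_algebra_def sigma_scale_sigma_fun sigma_add_sigma_fun sigma_pairs_scale distrib_right)
    show "sigma_scale N (a \<otimes>\<^bsub>?R\<^esub> b) x = sigma_scale N a (sigma_scale N b x)"
      using f by (simp add: ring_of_type_algebra_def sigma_scale_sigma_fun sigma_pairs_scale mult.assoc)
    show "sigma_scale N \<one>\<^bsub>?R\<^esub> x = x"
      using f by (simp add: ring_of_type_algebra_def sigma_scale_sigma_fun)
  qed (rule sigma_scale_carrier)
  moreover have "complex_hilbert_space_axioms (sigma_space N)"
  proof (rule complex_hilbert_space_axioms.intro; unfold sigma_space_simps)
    fix x y assume "x \<in> sigma_pairs N // sigma_rel N" "y \<in> sigma_pairs N // sigma_rel N"
    then obtain \<kappa> f g where f: "(f, \<kappa>) \<in> sigma_pairs N" "x = sigma_fun N f \<kappa>"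
      and g: "(g, \<kappa>) \<in> sigma_pairs N" "y = sigma_fun N g \<kappa>" by (rule sigma_pairE)
    show "sigma_inner N y x = cnj (sigma_inner N x y)"
    proof -
      have "(LINT \<omega>|\<kappa>. cnj (g \<omega>) * f \<omega>) = (LINT \<omega>|\<kappa>. cnj (cnj (f \<omega>) * g \<omega>))"
        by (simp add: mult.commute)
      then show ?thesis
        unfolding f(2) g(2) sigma_inner_sigma_fun[OF f(1) g(1)] sigma_inner_sigma_fun[OF g(1) f(1)]
        by (simp only: Bochner_Integration.integral_cnj)
    qed
    show "sigma_inner N x (sigma_scale N c y) = c * sigma_inner N x y" for c
      using f g by (simp add: sigma_inner_sigma_fun sigma_scale_sigma_fun sigma_pairs_scale
          mult.left_commute[of _ c])
  next
    fix x y z assume "x \<in> sigma_pairs N // sigma_rel N" "y \<in> sigma_pairs N // sigma_rel N"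
      "z \<in> sigma_pairs N // sigma_rel N"
    then show "sigma_inner N x (sigma_add N y z) = sigma_inner N x y + sigma_inner N x z"
      by (rule sigma_tripleE)
        (simp add: sigma_inner_sigma_fun sigma_add_sigma_fun sigma_pairs_add distrib_left integrable_cnj_mult)
  next
    fix x assume "x \<in> sigma_pairs N // sigma_rel N"
    then obtain \<kappa> f where f: "(f, \<kappa>) \<in> sigma_pairs N" "x = sigma_fun N f \<kappa>" by (rule sigma_carrierE)
    show "0 \<le> Re (sigma_inner N x x)" using f by (simp add: sigma_inner_self)
    assume "sigma_inner N x x = 0"
    then have "(LINT \<omega>|\<kappa>. (cmod (f \<omega>))\<^sup>2) = 0" using f by (simp add: sigma_inner_self)
    then have "AE \<omega> in \<kappa>. (cmod (f \<omega>))\<^sup>2 = 0"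
      using integral_nonneg_eq_0_iff_AE[OF sigma_pairsD(3)[OF f(1)]] by simp
    then have "AE \<omega> in \<kappa>. f \<omega> = 0" by simp
    then show "x = sigma_fun N (\<lambda>_. 0) (null_measure (word_borel N))"
      using f sigma_fun_eq_AE_iff[OF f(1) sigma_pairs_zero] sigma_zero_eq sigma_pairsD(1) by metis
  next
    fix u :: "nat \<Rightarrow> sigma_pair set"
    assume "\<And>n. u n \<in> sigma_pairs N // sigma_rel N"
      and cau: "\<And>e. 0 < e \<Longrightarrow> \<exists>M. \<forall>m\<ge>M. \<forall>n\<ge>M. hnorm (sigma_space N) (u m \<ominus>\<^bsub>sigma_space N\<^esub> u n) < e"
    then obtain \<kappa> h where \<kappa>: "\<kappa> \<in> finite_word_measures N" and h: "\<And>n. (h n, \<kappa>) \<in> sigma_pairs N"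
      and u: "\<And>n. u n = sigma_fun N (h n) \<kappa>" using sigma_sequenceE[of u N] by blast
    have n: "hnorm (sigma_space N) (sigma_fun N f \<kappa> \<ominus>\<^bsub>sigma_space N\<^esub> sigma_fun N g \<kappa>) =
        sqrt (LINT \<omega>|\<kappa>. (cmod (f \<omega> - g \<omega>))\<^sup>2)" if "(f, \<kappa>) \<in> sigma_pairs N" "(g, \<kappa>) \<in> sigma_pairs N" for f g
      using that by (simp add: sigma_minus_sigma_fun hnorm_sigma_fun sigma_pairs_minus)
    obtain g where g: "g \<in> borel_measurable \<kappa>" "integrable \<kappa> (\<lambda>x. (cmod (g x))\<^sup>2)"
      and lim: "(\<lambda>n. LINT x|\<kappa>. (cmod (h n x - g x))\<^sup>2) \<longlonglongrightarrow> 0"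
    proof -
      have "\<exists>K. \<forall>m\<ge>K. \<forall>n\<ge>K. (LINT x|\<kappa>. (cmod (h m x - h n x))\<^sup>2) < e" if e: "0 < e" for e
      proof -
        \<comment> \<open>The norm is the root of the integral, so \<open>e\<close> for the integral
          corresponds to \<open>sqrt e\<close> for the norm.\<close>
        obtain K where K: "\<And>m n. m \<ge> K \<Longrightarrow> n \<ge> K \<Longrightarrow> sqrt (LINT \<omega>|\<kappa>. (cmod (h m \<omega> - h n \<omega>))\<^sup>2) < sqrt e"
          using cau[of "sqrt e"] e unfolding u n[OF h h] by auto
        then show ?thesis by auto
      qed
      from square_integrable_complete[OF finite_word_measuresD(1)[OF \<kappa>] sigma_pairsD(2)[OF h]
          sigma_pairsD(3)[OF h] this]
      show ?thesis using that by auto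
    qed
    have g': "(g, \<kappa>) \<in> sigma_pairs N" using g \<kappa> by (simp add: sigma_pairs_def)
    show "\<exists>x\<in>sigma_pairs N // sigma_rel N. hconverges (sigma_space N) u x"
    proof (rule bexI)
      show "hconverges (sigma_space N) u (sigma_fun N g \<kappa>)"
        unfolding hconverges_def u n[OF h g'] using tendsto_real_sqrt[OF lim] by simp
    qed (rule sigma_fun_carrier[OF g'])
  qed
  ultimately show ?thesis by (rule complex_hilbert_space.intro)
qed

section \<open>Transport along partial isomorphisms\<close>

text \<open>A countable product of countable discrete spaces is second countable, so its Borel sets
  are generated by the coordinates.\<close>

lemma measurable_word_borelI:
  assumes "\<And>k. (\<lambda>x. f x k) \<in> borel_measurable M" "\<And>x. x \<in> space M \<Longrightarrow> f x \<in> words N"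
  shows "f \<in> measurable M (word_borel N)"
  unfolding word_borel_def
  by (intro measurable_restrict_space2 measurable_coordinatewise_then_product) (use assms in auto)

lemma measurable_word_coordinate [measurable]:
  "(\<lambda>\<omega>. \<omega> k) \<in> borel_measurable (word_borel N)"
  unfolding word_borel_def
  by (rule measurable_restrict_space1,
      rule measurable_product_then_coordinatewise[where f = "\<lambda>\<omega>. \<omega>", OF measurable_ident_sets[OF refl]])

lemma shift_measurable [measurable]: "shift \<in> measurable (word_borel N) (word_borel N)"
  by (rule measurable_word_borelI) (auto simp: shift_def words_def)

lemma prepend_measurable:
  assumes "i < N"
  shows "prepend i \<in> measurable (word_borel N) (word_borel N)"
proof (rule measurable_word_borelI)
  fix k
  show "(\<lambda>\<omega>. prepend i \<omega> k) \<in> borel_measurable (word_borel N)"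
    by (cases k) (simp_all add: prepend_def)
qed (use assms in \<open>auto simp: prepend_def words_def split: nat.splits\<close>)

lemma shift_prepend [simp]: "shift (prepend i \<omega>) = \<omega>"
  by (simp add: shift_def prepend_def)

lemma prepend_image_words:
  assumes "i < N"
  shows "prepend i ` words N = {\<omega> \<in> words N. \<omega> 0 = i}"
proof (intro equalityI subsetI)
  fix \<omega> assume \<omega>: "\<omega> \<in> {\<omega> \<in> words N. \<omega> 0 = i}"
  then have "\<omega> = prepend i (shift \<omega>)"
    by (auto simp: prepend_def shift_def fun_eq_iff split: nat.splits)
  moreover have "shift \<omega> \<in> words N" using \<omega> by (auto simp: shift_def words_def)
  ultimately show "\<omega> \<in> prepend i ` words N" by blast
qed (use assms in \<open>auto simp: prepend_def words_def split: nat.splits\<close>)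

lemma sets_coordinate_eq: "{\<omega> \<in> words N. \<omega> k = i} \<in> sets (word_borel N)"
proof -
  have "(\<lambda>\<omega>. \<omega> k) -` {i} \<inter> space (word_borel N) \<in> sets (word_borel N)"
    by (rule measurable_sets[OF measurable_word_coordinate]) simp
  then show ?thesis by (simp add: vimage_def Int_def conj_commute)
qed

lemma cylinder_sets [measurable]: "cylinder N w \<in> sets (word_borel N)"
proof -
  have "cylinder N w = words N \<inter> (\<Inter>k<length w. {\<omega> \<in> words N. \<omega> k = w ! k})"
    if "w \<noteq> []" using that by (auto simp: cylinder_def)
  then have "cylinder N w \<in> sets (word_borel N)" if "w \<noteq> []"
    using that sets.top[of "word_borel N"] by (auto intro!: sets.Int sets.finite_INT sets_coordinate_eq)
  moreover have "cylinder N [] \<in> sets (word_borel N)"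
    using sets.top[of "word_borel N"] by (simp add: cylinder_def)
  ultimately show ?thesis by blast
qed

text \<open>Since the alphabet is finite, fixing one coordinate gives a finite union of cylinders;
  hence all coordinates are measurable for the sigma-algebra that the cylinders generate.\<close>

lemma sets_word_borel_cylinders:
  "sets (word_borel N) = sigma_sets (words N) {cylinder N w | w. set w \<subseteq> {..<N}}"
    (is "_ = sigma_sets _ ?C")
proof
  have sub: "?C \<subseteq> Pow (words N)" by (auto simp: cylinder_def)
  let ?G = "sigma (words N) ?C"
  have sG: "sets ?G = sigma_sets (words N) ?C" "space ?G = words N"
    using sub by (simp_all add: sets_measure_of space_measure_of)
  have cylG: "cylinder N w \<in> sets ?G" if "set w \<subseteq> {..<N}" for w
    unfolding sG by (rule sigma_sets.Basic) (use that in blast)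
  have coord_vimage: "(\<lambda>\<omega>. \<omega> k) -` {i} \<inter> space ?G \<in> sets ?G" for k i
  proof -
    \<comment> \<open>The prefixes of length \<open>Suc k\<close> whose last letter, at position
      \<open>k\<close>, is \<open>i\<close>.\<close>
    let ?L = "{w. set w \<subseteq> {..<N} \<and> length w = Suc k \<and> w ! k = i}"
    have "finite ?L"
      by (rule finite_subset[OF _ finite_lists_length_eq[of "{..<N}" "Suc k"]]) auto
    then have "(\<Union>w\<in>?L. cylinder N w) \<in> sets ?G" by (rule sets.finite_UN) (simp add: cylG)
    moreover have "(\<lambda>\<omega>. \<omega> k) -` {i} \<inter> words N = (\<Union>w\<in>?L. cylinder N w)"
    proof (intro equalityI subsetI)
      fix \<omega> assume \<omega>: "\<omega> \<in> (\<lambda>\<omega>. \<omega> k) -` {i} \<inter> words N"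
      let ?w = "map \<omega> [0..<Suc k]"
      have "?w \<in> ?L" using \<omega> nth_map[of k "[0..<Suc k]" \<omega>] by (auto simp: words_def simp del: upt_Suc)
      moreover have "\<omega> \<in> cylinder N ?w" using \<omega> by (auto simp: cylinder_def simp del: upt_Suc)
      ultimately show "\<omega> \<in> (\<Union>w\<in>?L. cylinder N w)" by blast
    qed (auto simp: cylinder_def)
    ultimately show ?thesis by (simp add: sG(2))
  qed
  have coord: "(\<lambda>\<omega>. \<omega> k) \<in> measurable ?G (count_space UNIV)" for k
    using coord_vimage by (simp add: measurable_count_space_eq2_countable)
  \<comment> \<open>Measurability of the identity map is the inclusion of the Borel sets in the
    generated sigma-algebra.\<close>
  have "(\<lambda>\<omega>. \<omega>) \<in> measurable ?G (word_borel N)"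
  proof (rule measurable_word_borelI)
    fix k
    show "(\<lambda>\<omega>. \<omega> k) \<in> borel_measurable ?G"
      by (rule measurable_compose[OF coord]) simp
  qed (simp add: sG)
  then have "A \<in> sets ?G" if "A \<in> sets (word_borel N)" for A
    using measurable_sets[of "\<lambda>\<omega>. \<omega>" ?G "word_borel N" A] that sets.sets_into_space[OF that]
    by (simp add: sG Int_absorb2)
  then show "sets (word_borel N) \<subseteq> sigma_sets (words N) ?C" using sG by auto
  show "sigma_sets (words N) ?C \<subseteq> sets (word_borel N)"
    using sets.sigma_sets_subset[of ?C "word_borel N", unfolded space_word_borel] cylinder_sets by blast
qed

section \<open>Restriction and push-forward of measures\<close>

text \<open>As a density the restriction keeps the space of all words and becomes accessible to the
  theorems on integrals and null sets of densities.\<close>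

lemma restrict_meas_eq_density:
  assumes "A \<in> sets \<mu>"
  shows "restrict_meas \<mu> A = density \<mu> (indicator A)"
  unfolding restrict_meas_def density_def
proof (rule measure_of_eq[OF sets.space_closed])
  fix B assume "B \<in> sigma_sets (space \<mu>) (sets \<mu>)"
  then have "B \<in> sets \<mu>" by (simp add: sets.sigma_sets_eq)
  with assms have "(\<integral>\<^sup>+x. indicator A x * indicator B x \<partial>\<mu>) = emeasure \<mu> (A \<inter> B)"
    by (simp flip: indicator_inter_arith)
  then show "emeasure \<mu> (A \<inter> B) = (\<integral>\<^sup>+x. indicator A x * indicator B x \<partial>\<mu>)" by simp
qed

lemma restrict_meas_finite_word_measure:
  assumes \<mu>: "\<mu> \<in> finite_word_measures N" and A: "A \<in> sets (word_borel N)"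
  shows "restrict_meas \<mu> A \<in> finite_word_measures N"
proof -
  have A': "A \<in> sets \<mu>" using finite_word_measuresD(3)[OF \<mu>] A by simp
  interpret finite_measure \<mu> by (rule finite_word_measuresD[OF \<mu>])
  have "finite_measure (restrict_meas \<mu> A)"
    unfolding restrict_meas_eq_density[OF A']
    using A' sets.sets_into_space[OF A']
    by (intro finite_measureI) (simp add: emeasure_restricted)
  then show ?thesis
    using finite_word_measuresD(3)[OF \<mu>] A' by (simp add: finite_word_measures_def restrict_meas_eq_density)
qed

lemma distr_finite_word_measure:
  assumes \<mu>: "\<mu> \<in> finite_word_measures N" and a: "a \<in> measurable (word_borel N) (word_borel N)"
  shows "distr \<mu> (word_borel N) a \<in> finite_word_measures N"
proof -
  have "a \<in> measurable \<mu> (word_borel N)"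
    using a measurable_cong_sets[OF finite_word_measuresD(3)[OF \<mu>] refl] by blast
  then show ?thesis
    using finite_measure.finite_measure_distr[OF finite_word_measuresD(1)[OF \<mu>]]
    by (simp add: finite_word_measures_def)
qed

text \<open>
  The operators of the representation, their adjoints and the multiplications by indicator
  functions are all transports of sigma-functions along a partial isomorphism \<open>a\<close> from
  \<open>A\<close> onto \<open>B\<close> with inverse \<open>b\<close>.
\<close>

definition sigma_transport ::
    "nat \<Rightarrow> (nat \<Rightarrow> nat) set \<Rightarrow> ((nat \<Rightarrow> nat) \<Rightarrow> nat \<Rightarrow> nat) \<Rightarrow> ((nat \<Rightarrow> nat) \<Rightarrow> nat \<Rightarrow> nat)
      \<Rightarrow> sigma_pair set \<Rightarrow> sigma_pair set" where
  "sigma_transport N A a b u =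
     (THE Z. \<forall>f \<mu>. (f, \<mu>) \<in> u \<longrightarrow>
        Z = sigma_fun N (f \<circ> b) (distr (restrict_meas \<mu> A) (word_borel N) a))"

text \<open>Both maps are total and measurable on all words and are inverse to each other only
  between \<open>A\<close> and \<open>B\<close>. All measures thus stay on the one space
  \<open>word_borel N\<close>, and the restriction to \<open>A\<close> cuts off the part where the
  maps are uncontrolled.\<close>

locale word_partial_iso =
  fixes N :: nat and A B :: "(nat \<Rightarrow> nat) set" and a b :: "(nat \<Rightarrow> nat) \<Rightarrow> nat \<Rightarrow> nat"
  assumes A_sets: "A \<in> sets (word_borel N)" and B_sets: "B \<in> sets (word_borel N)"
    and a_meas: "a \<in> measurable (word_borel N) (word_borel N)"
    and b_meas: "b \<in> measurable (word_borel N) (word_borel N)"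
    and a_in: "\<omega> \<in> A \<Longrightarrow> a \<omega> \<in> B" and b_in: "\<omega> \<in> B \<Longrightarrow> b \<omega> \<in> A"
    and b_a: "\<omega> \<in> A \<Longrightarrow> b (a \<omega>) = \<omega>" and a_b: "\<omega> \<in> B \<Longrightarrow> a (b \<omega>) = \<omega>"
begin

abbreviation push :: "(nat \<Rightarrow> nat) measure \<Rightarrow> (nat \<Rightarrow> nat) measure" where
  "push \<mu> \<equiv> distr (restrict_meas \<mu> A) (word_borel N) a"

lemma push_finite_word_measure: "\<mu> \<in> finite_word_measures N \<Longrightarrow> push \<mu> \<in> finite_word_measures N"
  by (intro distr_finite_word_measure restrict_meas_finite_word_measure A_sets a_meas)

context
  fixes \<mu> assumes \<mu>: "\<mu> \<in> finite_word_measures N"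
begin

lemma A_in_sets: "A \<in> sets \<mu>"
  using finite_word_measuresD(3)[OF \<mu>] A_sets by simp

lemma measurable_word_measureI: "h \<in> measurable (word_borel N) M \<Longrightarrow> h \<in> measurable \<mu> M"
  using measurable_cong_sets[OF finite_word_measuresD(3)[OF \<mu>] refl] by blast

lemma measurable_restrict_measI: "h \<in> measurable (word_borel N) M \<Longrightarrow> h \<in> measurable (restrict_meas \<mu> A) M"
  using measurable_word_measureI by (simp add: restrict_meas_eq_density[OF A_in_sets] measurable_density_eq1)

lemma integrable_push_iff:
  fixes h :: "(nat \<Rightarrow> nat) \<Rightarrow> 'c :: {banach, second_countable_topology}"
  assumes h: "h \<in> borel_measurable (word_borel N)"
  shows "integrable (push \<mu>) (\<lambda>\<omega>. h (b \<omega>)) \<longleftrightarrow> integrable \<mu> (\<lambda>\<omega>. indicator A \<omega> *\<^sub>R h \<omega>)"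
proof -
  have hb: "(\<lambda>\<omega>. h (b \<omega>)) \<in> borel_measurable (word_borel N)"
    by (rule measurable_compose[OF b_meas h])
  have hba: "(\<lambda>\<omega>. h (b (a \<omega>))) \<in> borel_measurable (word_borel N)"
    by (rule measurable_compose[OF a_meas hb])
  have "integrable (push \<mu>) (\<lambda>\<omega>. h (b \<omega>)) \<longleftrightarrow> integrable (restrict_meas \<mu> A) (\<lambda>\<omega>. h (b (a \<omega>)))"
    by (rule integrable_distr_eq[OF measurable_restrict_measI[OF a_meas] hb])
  also have "\<dots> \<longleftrightarrow> integrable \<mu> (\<lambda>\<omega>. indicator A \<omega> *\<^sub>R h (b (a \<omega>)))"
    unfolding restrict_meas_eq_density[OF A_in_sets] ennreal_indicator[symmetric]
    by (rule integrable_density) (use measurable_word_measureI[OF hba] A_in_sets in auto)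
  also have "\<dots> \<longleftrightarrow> integrable \<mu> (\<lambda>\<omega>. indicator A \<omega> *\<^sub>R h \<omega>)"
    by (intro Bochner_Integration.integrable_cong) (auto simp: indicator_def b_a)
  finally show ?thesis .
qed

text \<open>Pulling back along \<open>a\<close> turns \<open>h \<circ> b\<close> into
  \<open>h \<circ> b \<circ> a\<close>, which is \<open>h\<close> on \<open>A\<close>; outside
  \<open>A\<close> the indicator vanishes.\<close>

lemma integral_push:
  fixes h :: "(nat \<Rightarrow> nat) \<Rightarrow> 'c :: {banach, second_countable_topology}"
  assumes h: "h \<in> borel_measurable (word_borel N)"
  shows "(LINT \<omega>|push \<mu>. h (b \<omega>)) = (LINT \<omega>|\<mu>. indicator A \<omega> *\<^sub>R h \<omega>)"
proof -
  have hb: "(\<lambda>\<omega>. h (b \<omega>)) \<in> borel_measurable (word_borel N)"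
    by (rule measurable_compose[OF b_meas h])
  have hba: "(\<lambda>\<omega>. h (b (a \<omega>))) \<in> borel_measurable (word_borel N)"
    by (rule measurable_compose[OF a_meas hb])
  have "(LINT \<omega>|push \<mu>. h (b \<omega>)) = (LINT \<omega>|restrict_meas \<mu> A. h (b (a \<omega>)))"
    by (rule integral_distr[OF measurable_restrict_measI[OF a_meas] hb])
  also have "\<dots> = (LINT \<omega>|\<mu>. indicator A \<omega> *\<^sub>R h (b (a \<omega>)))"
    unfolding restrict_meas_eq_density[OF A_in_sets] ennreal_indicator[symmetric]
    by (rule integral_density) (use measurable_word_measureI[OF hba] A_in_sets in auto)
  also have "\<dots> = (LINT \<omega>|\<mu>. indicator A \<omega> *\<^sub>R h \<omega>)"
    by (intro Bochner_Integration.integral_cong) (auto simp: indicator_def b_a)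
  finally show ?thesis .
qed

lemma AE_pushI:
  assumes "AE \<omega> in \<mu>. \<omega> \<in> A \<longrightarrow> P (a \<omega>)" "{\<omega> \<in> words N. P \<omega>} \<in> sets (word_borel N)"
  shows "AE \<omega> in push \<mu>. P \<omega>"
proof -
  have "AE \<omega> in restrict_meas \<mu> A. P (a \<omega>)"
    unfolding restrict_meas_eq_density[OF A_in_sets]
    using assms(1) A_in_sets by (simp add: AE_density) (auto elim!: AE_mp)
  then show ?thesis using AE_distr_iff[OF measurable_restrict_measI[OF a_meas], of P] assms(2) by simp
qed

end

text \<open>The density is carried along by \<open>b\<close>. Both sides are push-forwards of
  densities of \<open>\<kappa>\<close>, and these coincide because \<open>b \<circ> a\<close> is the
  identity on \<open>A\<close>.\<close>

lemma push_density:
  assumes \<kappa>: "\<kappa> \<in> finite_word_measures N" and p: "p \<in> borel_measurable (word_borel N)"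
  shows "push (density \<kappa> p) = density (push \<kappa>) (\<lambda>\<omega>. p (b \<omega>))"
proof -
  have A': "A \<in> sets \<kappa>" by (rule A_in_sets[OF \<kappa>])
  have pb: "(\<lambda>\<omega>. p (b \<omega>)) \<in> borel_measurable (word_borel N)"
    by (rule measurable_compose[OF b_meas p])
  have pba: "(\<lambda>\<omega>. p (b (a \<omega>))) \<in> borel_measurable (word_borel N)"
    by (rule measurable_compose[OF a_meas pb])
  have "density (push \<kappa>) (\<lambda>\<omega>. p (b \<omega>)) =
      distr (density (restrict_meas \<kappa> A) (\<lambda>\<omega>. p (b (a \<omega>)))) (word_borel N) a"
    by (rule density_distr[OF pb measurable_restrict_measI[OF \<kappa> a_meas]])
  also have "density (restrict_meas \<kappa> A) (\<lambda>\<omega>. p (b (a \<omega>))) =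
      density \<kappa> (\<lambda>\<omega>. indicator A \<omega> * p (b (a \<omega>)))"
    unfolding restrict_meas_eq_density[OF A']
    by (rule density_density_eq) (use A' measurable_word_measureI[OF \<kappa> pba] in auto)
  also have "(\<lambda>\<omega>. indicator A \<omega> * p (b (a \<omega>))) = (\<lambda>\<omega>. p \<omega> * indicator A \<omega>)"
    by (auto simp: indicator_def b_a)
  also have "density \<kappa> (\<lambda>\<omega>. p \<omega> * indicator A \<omega>) = density (density \<kappa> p) (indicator A)"
    by (rule density_density_eq[symmetric]) (use A' measurable_word_measureI[OF \<kappa> p] in auto)
  also have "\<dots> = restrict_meas (density \<kappa> p) A"
    by (rule restrict_meas_eq_density[symmetric]) (use A' in auto)
  finally show ?thesis by simp
qed

lemma sigma_pairs_transport:
  assumes f: "(f, \<mu>) \<in> sigma_pairs N"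
  shows "(f \<circ> b, push \<mu>) \<in> sigma_pairs N"
proof (rule sigma_pairsI)
  note m = sigma_pairsD[OF f]
  note [measurable] = m(4)
  show "push \<mu> \<in> finite_word_measures N" by (rule push_finite_word_measure[OF m(1)])
  show "f \<circ> b \<in> borel_measurable (word_borel N)" by (rule measurable_comp[OF b_meas m(4)])
  have i: "integrable \<mu> (\<lambda>\<omega>. indicator A \<omega> *\<^sub>R (cmod (f \<omega>))\<^sup>2)"
    using integrable_mult_indicator[OF A_in_sets[OF m(1)] m(3)] .
  have "(\<lambda>\<omega>. (cmod (f \<omega>))\<^sup>2) \<in> borel_measurable (word_borel N)" by measurable
  from integrable_push_iff[OF m(1) this] i
  show "integrable (push \<mu>) (\<lambda>\<omega>. (cmod ((f \<circ> b) \<omega>))\<^sup>2)" by simp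
qed

lemma sigma_fun_transport_cong_AE:
  assumes f: "(f, \<kappa>) \<in> sigma_pairs N" and g: "(g, \<kappa>) \<in> sigma_pairs N"
    and ae: "AE \<omega> in \<kappa>. f \<omega> = g \<omega>"
  shows "sigma_fun N (f \<circ> b) (push \<kappa>) = sigma_fun N (g \<circ> b) (push \<kappa>)"
proof -
  have "AE \<omega> in push \<kappa>. (f \<circ> b) \<omega> = (g \<circ> b) \<omega>"
  proof (rule AE_pushI)
    show "\<kappa> \<in> finite_word_measures N" by (rule sigma_pairsD[OF f])
    show "AE \<omega> in \<kappa>. \<omega> \<in> A \<longrightarrow> (f \<circ> b) (a \<omega>) = (g \<circ> b) (a \<omega>)"
      using ae by eventually_elim (simp add: b_a)
    note [measurable] = sigma_pairsD(4)[OF f] sigma_pairsD(4)[OF g] b_meas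
    have "{\<omega> \<in> space (word_borel N). (f \<circ> b) \<omega> = (g \<circ> b) \<omega>} \<in> sets (word_borel N)"
      unfolding o_def by measurable
    then show "{\<omega> \<in> words N. (f \<circ> b) \<omega> = (g \<circ> b) \<omega>} \<in> sets (word_borel N)" by simp
  qed
  then show ?thesis
    using sigma_fun_eq_AE_iff[OF sigma_pairs_transport[OF f] sigma_pairs_transport[OF g]] by simp
qed

text \<open>Transport commutes with the change to a dominating measure: by
  \<open>push_density\<close> the density of \<open>push \<mu>\<close> over
  \<open>push \<kappa>\<close> is explicit, and its root is the old root composed with
  \<open>b\<close>.\<close>

lemma sigma_fun_transport_dominating:
  assumes f: "(f, \<mu>) \<in> sigma_pairs N" and \<kappa>: "\<kappa> \<in> finite_word_measures N"
    and ac: "absolutely_continuous \<kappa> \<mu>"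
  shows "sigma_fun N (f \<circ> b) (push \<mu>) = sigma_fun N ((\<lambda>\<omega>. f \<omega> * sqrt_deriv \<mu> \<kappa> \<omega>) \<circ> b) (push \<kappa>)"
proof -
  let ?p = "\<lambda>\<omega>. (cmod (sqrt_deriv \<mu> \<kappa> \<omega>))\<^sup>2"
  note [measurable] = sqrt_deriv_measurable_word_borel[OF \<kappa>] b_meas
  have "push \<mu> = push (density \<kappa> (\<lambda>\<omega>. ennreal (?p \<omega>)))"
    using density_sqrt_deriv[OF \<kappa> sigma_pairsD(1)[OF f] ac] by simp
  also have "\<dots> = density (push \<kappa>) (\<lambda>\<omega>. ennreal (?p (b \<omega>)))"
    by (rule push_density[OF \<kappa>]) measurable
  finally have e: "push \<mu> = density (push \<kappa>) (\<lambda>\<omega>. ennreal (?p (b \<omega>)))" .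
  have "(\<lambda>\<omega>. ?p (b \<omega>)) \<in> borel_measurable (word_borel N)" by measurable
  then have "sigma_fun N (f \<circ> b) (push \<mu>) =
      sigma_fun N (\<lambda>\<omega>. (f \<circ> b) \<omega> * of_real (sqrt (?p (b \<omega>)))) (push \<kappa>)"
    by (rule sigma_fun_density(2)[OF sigma_pairs_transport[OF f] push_finite_word_measure[OF \<kappa>] _ _ e]) simp
  also have "(\<lambda>\<omega>. (f \<circ> b) \<omega> * of_real (sqrt (?p (b \<omega>)))) = (\<lambda>\<omega>. f \<omega> * sqrt_deriv \<mu> \<kappa> \<omega>) \<circ> b"
    by (auto simp: fun_eq_iff sqrt_deriv_eq_of_real[symmetric])
  finally show ?thesis .
qed

text \<open>Independence of the representative: both are first moved to one dominating measure,
  where they agree almost everywhere, and transport respects such agreement.\<close>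

lemma transport_sigma_fun:
  assumes f: "(f, \<mu>) \<in> sigma_pairs N"
  shows "sigma_transport N A a b (sigma_fun N f \<mu>) = sigma_fun N (f \<circ> b) (push \<mu>)"
  unfolding sigma_transport_def
proof (rule the_sigma_fun_eq[OF f, where F = "\<lambda>f \<mu>. sigma_fun N (f \<circ> b) (push \<mu>)"])
  fix g \<nu> assume g: "(g, \<nu>) \<in> sigma_fun N f \<mu>"
  note m = mem_sigma_funD[OF g]
  obtain \<kappa> where \<kappa>: "\<kappa> \<in> finite_word_measures N" and ac: "absolutely_continuous \<kappa> \<nu>" "absolutely_continuous \<kappa> \<mu>"
    using ex_dominating_measure_finite[of "{\<nu>, \<mu>}" N] sigma_pairsD(1)[OF m(1)] sigma_pairsD(1)[OF m(2)]
    by auto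
  have d: "dominates N \<kappa> \<nu> \<mu>" using \<kappa> ac by (simp add: dominates_def)
  have "AE \<omega> in \<kappa>. g \<omega> * sqrt_deriv \<nu> \<kappa> \<omega> = f \<omega> * sqrt_deriv \<mu> \<kappa> \<omega>"
    using m(3) unfolding sigma_fun_eq_iff[OF m(1,2)] sigma_rel_iff[OF m(1,2) d] .
  then show "sigma_fun N (g \<circ> b) (push \<nu>) = sigma_fun N (f \<circ> b) (push \<mu>)"
    unfolding sigma_fun_transport_dominating[OF m(1) \<kappa> ac(1)] sigma_fun_transport_dominating[OF m(2) \<kappa> ac(2)]
    by (intro sigma_fun_transport_cong_AE sigma_pairs_sqrt_deriv m \<kappa> ac)
qed

lemma transport_carrier:
  assumes "u \<in> sigma_pairs N // sigma_rel N"
  shows "sigma_transport N A a b u \<in> sigma_pairs N // sigma_rel N"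
  using assms by (rule sigma_carrierE) (simp add: transport_sigma_fun sigma_fun_carrier sigma_pairs_transport)

lemma transport_linear: "linear_operator (sigma_space N) (sigma_transport N A a b)"
  unfolding linear_operator_def sigma_space_simps
proof (intro conjI ballI allI)
  fix u v assume "u \<in> sigma_pairs N // sigma_rel N" "v \<in> sigma_pairs N // sigma_rel N"
  then obtain \<kappa> f g where f: "(f, \<kappa>) \<in> sigma_pairs N" "u = sigma_fun N f \<kappa>"
    and g: "(g, \<kappa>) \<in> sigma_pairs N" "v = sigma_fun N g \<kappa>" by (rule sigma_pairE)
  show "sigma_transport N A a b (sigma_add N u v) =
      sigma_add N (sigma_transport N A a b u) (sigma_transport N A a b v)"
    using f g by (simp add: sigma_add_sigma_fun transport_sigma_fun sigma_pairs_add sigma_pairs_transport o_def)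
      (simp add: sigma_add_sigma_fun sigma_pairs_transport[unfolded o_def])
next
  fix c u assume "u \<in> sigma_pairs N // sigma_rel N"
  then obtain f \<mu> where f: "(f, \<mu>) \<in> sigma_pairs N" "u = sigma_fun N f \<mu>" by (rule sigma_carrierE)
  show "sigma_transport N A a b (sigma_scale N c u) = sigma_scale N c (sigma_transport N A a b u)"
    using f by (simp add: sigma_scale_sigma_fun transport_sigma_fun sigma_pairs_scale sigma_pairs_transport o_def)
      (simp add: sigma_scale_sigma_fun sigma_pairs_transport[unfolded o_def])
qed (rule transport_carrier)

text \<open>The partial isometry property: the inner product keeps exactly the part over
  \<open>A\<close>.\<close>

lemma inner_transport:
  assumes f: "(f, \<kappa>) \<in> sigma_pairs N" and g: "(g, \<kappa>) \<in> sigma_pairs N"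
  shows "sigma_inner N (sigma_transport N A a b (sigma_fun N f \<kappa>)) (sigma_transport N A a b (sigma_fun N g \<kappa>)) =
    (LINT \<omega>|\<kappa>. indicator A \<omega> * (cnj (f \<omega>) * g \<omega>))"
proof -
  note [measurable] = sigma_pairsD(4)[OF f] sigma_pairsD(4)[OF g]
  have "(\<lambda>\<omega>. cnj (f \<omega>) * g \<omega>) \<in> borel_measurable (word_borel N)" by measurable
  from integral_push[OF sigma_pairsD(1)[OF f] this] show ?thesis
    by (simp add: transport_sigma_fun f g sigma_inner_sigma_fun[OF sigma_pairs_transport[OF f] sigma_pairs_transport[OF g]]
        scaleR_conv_of_real of_real_indicator)
qed

end

text \<open>Functoriality. The composite is supplied as a separate partial isomorphism, so an
  operator identity follows by checking the domain and the forward map pointwise.\<close>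

lemma transport_transport:
  assumes iso1: "word_partial_iso N A B a b" and iso2: "word_partial_iso N A' B' a' b'"
    and iso3: "word_partial_iso N C D c d"
    and C: "\<And>\<omega>. \<omega> \<in> words N \<Longrightarrow> \<omega> \<in> C \<longleftrightarrow> \<omega> \<in> A \<and> a \<omega> \<in> A'"
    and c: "\<And>\<omega>. \<omega> \<in> C \<Longrightarrow> c \<omega> = a' (a \<omega>)"
    and u: "u \<in> sigma_pairs N // sigma_rel N"
  shows "sigma_transport N A' a' b' (sigma_transport N A a b u) = sigma_transport N C c d u"
proof -
  interpret i1: word_partial_iso N A B a b by fact
  interpret i2: word_partial_iso N A' B' a' b' by fact
  interpret i3: word_partial_iso N C D c d by fact
  obtain f \<mu> where f: "(f, \<mu>) \<in> sigma_pairs N" and uf: "u = sigma_fun N f \<mu>"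
    using u by (rule sigma_carrierE)
  have \<mu>: "\<mu> \<in> finite_word_measures N" by (rule sigma_pairsD[OF f])
  have p1: "i1.push \<mu> \<in> finite_word_measures N" by (rule i1.push_finite_word_measure[OF \<mu>])
  have A'1: "A' \<in> sets (i1.push \<mu>)" using i2.A_sets by simp
  have meq: "i2.push (i1.push \<mu>) = i3.push \<mu>"
  proof (rule measure_eqI)
    fix E assume "E \<in> sets (i2.push (i1.push \<mu>))"
    then have E: "E \<in> sets (word_borel N)" by simp
    have pre: "h -` E' \<inter> words N \<in> sets (word_borel N)"
      if "h \<in> measurable (word_borel N) (word_borel N)" "E' \<in> sets (word_borel N)" for h E'
      using measurable_sets[OF that] by simp
    have sub: "G \<subseteq> words N" if "G \<in> sets (word_borel N)" for G
      using sets.sets_into_space[OF that] by simp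
    have r: "emeasure (restrict_meas \<nu> F) G = emeasure \<nu> (F \<inter> G)"
      if "F \<in> sets (word_borel N)" "G \<in> sets (word_borel N)" "\<nu> \<in> finite_word_measures N" for F G \<nu>
      using that finite_word_measuresD(3)[OF that(3)] by (simp add: restrict_meas_eq_density emeasure_restricted)
    have sp: "space (restrict_meas \<nu> F) = words N"
      if "F \<in> sets (word_borel N)" "\<nu> \<in> finite_word_measures N" for F \<nu>
      using finite_word_measuresD(4)[OF restrict_meas_finite_word_measure[OF that(2,1)]] .
    have d: "emeasure (distr (restrict_meas \<nu> F) (word_borel N) h) G = emeasure \<nu> (F \<inter> (h -` G \<inter> words N))"
      if "F \<in> sets (word_borel N)" "G \<in> sets (word_borel N)" "\<nu> \<in> finite_word_measures N"
        "h \<in> measurable (word_borel N) (word_borel N)" for F G \<nu> h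
    proof -
      have "h \<in> measurable (restrict_meas \<nu> F) (word_borel N)"
        using that(4) measurable_cong_sets[OF finite_word_measuresD(3)[OF restrict_meas_finite_word_measure[OF that(3,1)]] refl]
        by blast
      then show ?thesis using that pre[OF that(4,2)] by (simp add: emeasure_distr sp r)
    qed
    have "emeasure (i2.push (i1.push \<mu>)) E = emeasure \<mu> (A \<inter> (a -` (A' \<inter> (a' -` E \<inter> words N)) \<inter> words N))"
      using i1.A_sets i2.A_sets i1.a_meas i2.a_meas E \<mu> p1 pre[OF i2.a_meas E] by (simp add: d)
    \<comment> \<open>Both sets consist of the words on which the composite map is defined and leads
      into \<open>E\<close>.\<close>
    also have "A \<inter> (a -` (A' \<inter> (a' -` E \<inter> words N)) \<inter> words N) = C \<inter> (c -` E \<inter> words N)"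
      using C c measurable_space[OF i1.a_meas] by auto
    also have "emeasure \<mu> \<dots> = emeasure (i3.push \<mu>) E"
      using i3.A_sets i3.a_meas E \<mu> by (simp add: d)
    finally show "emeasure (i2.push (i1.push \<mu>)) E = emeasure (i3.push \<mu>) E" .
  qed simp
  have q: "(f \<circ> b \<circ> b', i3.push \<mu>) \<in> sigma_pairs N"
    using i2.sigma_pairs_transport[OF i1.sigma_pairs_transport[OF f]] unfolding meq .
  \<comment> \<open>Nothing relates \<open>b \<circ> b'\<close> to \<open>d\<close> outside the
    image of \<open>C\<close>, but the pushed measure sees only that image, and there both undo
    \<open>c\<close>.\<close>
  have "AE \<omega> in i3.push \<mu>. (f \<circ> b \<circ> b') \<omega> = (f \<circ> d) \<omega>"
  proof (rule i3.AE_pushI[OF \<mu>])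
    show "AE \<omega> in \<mu>. \<omega> \<in> C \<longrightarrow> (f \<circ> b \<circ> b') (c \<omega>) = (f \<circ> d) (c \<omega>)"
    proof (intro AE_I2 impI)
      fix \<omega> assume \<omega>: "\<omega> \<in> C"
      then have "\<omega> \<in> words N" using sets.sets_into_space[OF i3.A_sets] by auto
      with \<omega> C have "\<omega> \<in> A" "a \<omega> \<in> A'" by auto
      then show "(f \<circ> b \<circ> b') (c \<omega>) = (f \<circ> d) (c \<omega>)"
        using \<omega> c i1.b_a i2.b_a i3.b_a by simp
    qed
    note [measurable] = sigma_pairsD(4)[OF f] i1.b_meas i2.b_meas i3.b_meas
    have "{\<omega> \<in> space (word_borel N). (f \<circ> b \<circ> b') \<omega> = (f \<circ> d) \<omega>} \<in> sets (word_borel N)"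
      unfolding o_def by measurable
    then show "{\<omega> \<in> words N. (f \<circ> b \<circ> b') \<omega> = (f \<circ> d) \<omega>} \<in> sets (word_borel N)" by simp
  qed
  then have "sigma_fun N (f \<circ> b \<circ> b') (i3.push \<mu>) = sigma_fun N (f \<circ> d) (i3.push \<mu>)"
    using sigma_fun_eq_AE_iff[OF q i3.sigma_pairs_transport[OF f]] by simp
  then show ?thesis
    by (simp add: uf f i1.transport_sigma_fun i2.transport_sigma_fun i3.transport_sigma_fun i1.sigma_pairs_transport meq)
qed

section \<open>The representation and its projection valued measure\<close>

lemma (in complex_hilbert_space) hadjoint_eqI:
  assumes z: "z \<in> carrier H" and adj: "\<And>x. x \<in> carrier H \<Longrightarrow> hinner H (T x) y = hinner H x z"
  shows "hadjoint H T y = z"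
  unfolding hadjoint_def
proof (rule the_equality)
  fix z' assume z': "z' \<in> carrier H \<and> (\<forall>x\<in>carrier H. hinner H (T x) y = hinner H x z')"
  let ?d = "z' \<ominus>\<^bsub>H\<^esub> z"
  have d: "?d \<in> carrier H" using z z' by simp
  have e: "z' = z \<oplus>\<^bsub>H\<^esub> ?d" using z z' by (simp add: a_minus_def a_lcomm[of z z'] r_neg)
  \<comment> \<open>Both candidates have the same inner product with every vector; testing with
    their difference leaves its squared norm equal to 0.\<close>
  have "hinner H ?d z' = hinner H ?d z + hinner H ?d ?d"
    by (subst e) (rule hinner_add_right[OF d z d])
  then have "hinner H ?d ?d = 0" using adj[OF d] z' d by simp
  then have "?d = \<zero>\<^bsub>H\<^esub>" by (rule hinner_definite[OF d])
  then show "z' = z" using e z by simp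
qed (use assms in auto)

lemma word_partial_iso_sym: "word_partial_iso N A B a b \<Longrightarrow> word_partial_iso N B A b a"
  by (simp add: word_partial_iso_def)

lemma word_partial_iso_id: "A \<in> sets (word_borel N) \<Longrightarrow> word_partial_iso N A A (\<lambda>\<omega>. \<omega>) (\<lambda>\<omega>. \<omega>)"
  by (simp add: word_partial_iso_def)

abbreviation sigma_restrict :: "nat \<Rightarrow> (nat \<Rightarrow> nat) set \<Rightarrow> sigma_pair set \<Rightarrow> sigma_pair set" where
  "sigma_restrict N A \<equiv> sigma_transport N A (\<lambda>\<omega>. \<omega>) (\<lambda>\<omega>. \<omega>)"

text \<open>Pushing along the identity leaves the restricted measure, whose density is the indicator
  of \<open>A\<close>; an indicator equals its own root.\<close>

lemma sigma_restrict_sigma_fun: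
  assumes A: "A \<in> sets (word_borel N)" and f: "(f, \<mu>) \<in> sigma_pairs N"
  shows "sigma_restrict N A (sigma_fun N f \<mu>) = sigma_fun N (\<lambda>\<omega>. indicator A \<omega> * f \<omega>) \<mu>"
proof -
  interpret word_partial_iso N A A "\<lambda>\<omega>. \<omega>" "\<lambda>\<omega>. \<omega>" by (rule word_partial_iso_id[OF A])
  have \<mu>: "\<mu> \<in> finite_word_measures N" by (rule sigma_pairsD[OF f])
  note r = restrict_meas_eq_density[OF A_in_sets[OF \<mu>]]
  have "push \<mu> = restrict_meas \<mu> A"
    by (rule distr_id2) (simp add: r finite_word_measuresD(3)[OF \<mu>])
  then have e: "push \<mu> = density \<mu> (\<lambda>\<omega>. ennreal (indicator A \<omega>))" by (simp add: r ennreal_indicator)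
  have m: "(indicator A :: _ \<Rightarrow> real) \<in> borel_measurable (word_borel N)" using A by simp
  have "sigma_restrict N A (sigma_fun N f \<mu>) = sigma_fun N (f \<circ> (\<lambda>\<omega>. \<omega>)) (push \<mu>)"
    by (rule transport_sigma_fun[OF f])
  also have "\<dots> = sigma_fun N (\<lambda>\<omega>. (f \<circ> (\<lambda>\<omega>. \<omega>)) \<omega> * of_real (sqrt (indicator A \<omega>))) \<mu>"
    by (rule sigma_fun_density(2)[OF sigma_pairs_transport[OF f] \<mu> m _ e]) simp
  also have "(\<lambda>\<omega>. (f \<circ> (\<lambda>\<omega>. \<omega>)) \<omega> * of_real (sqrt (indicator A \<omega>))) = (\<lambda>\<omega>. indicator A \<omega> * f \<omega>)"
    by (auto simp: indicator_def)
  finally show ?thesis .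
qed

lemma sigma_restrict_words:
  assumes "u \<in> sigma_pairs N // sigma_rel N"
  shows "sigma_restrict N (words N) u = u"
proof -
  obtain f \<mu> where f: "(f, \<mu>) \<in> sigma_pairs N" and u: "u = sigma_fun N f \<mu>"
    using assms by (rule sigma_carrierE)
  have W: "words N \<in> sets (word_borel N)" using sets.top[of "word_borel N"] by simp
  have "AE \<omega> in \<mu>. indicator (words N) \<omega> * f \<omega> = f \<omega>"
    by (rule AE_I2) (use finite_word_measuresD(4)[OF sigma_pairsD(1)[OF f]] in simp)
  then show ?thesis
    unfolding u sigma_restrict_sigma_fun[OF W f]
    using sigma_fun_eq_AE_iff[OF sigma_pairs_indicator[OF f W] f] by simp
qed

lemma sigma_restrict_carrier:
  "A \<in> sets (word_borel N) \<Longrightarrow> u \<in> sigma_pairs N // sigma_rel N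
    \<Longrightarrow> sigma_restrict N A u \<in> sigma_pairs N // sigma_rel N"
  by (rule word_partial_iso.transport_carrier[OF word_partial_iso_id])

lemma cnj_indicator: "cnj (indicator A x) = indicator A x"
  by (simp add: indicator_def)

lemma sigma_restrict_symmetric:
  assumes A: "A \<in> sets (word_borel N)"
    and u: "u \<in> sigma_pairs N // sigma_rel N" and v: "v \<in> sigma_pairs N // sigma_rel N"
  shows "sigma_inner N (sigma_restrict N A u) v = sigma_inner N u (sigma_restrict N A v)"
proof -
  obtain \<kappa> f g where f: "(f, \<kappa>) \<in> sigma_pairs N" "u = sigma_fun N f \<kappa>"
    and g: "(g, \<kappa>) \<in> sigma_pairs N" "v = sigma_fun N g \<kappa>" using u v by (rule sigma_pairE)
  show ?thesis
    using f g A
    by (simp add: sigma_restrict_sigma_fun sigma_inner_sigma_fun sigma_pairs_indicator cnj_indicator)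
      (simp add: mult_ac)
qed

text \<open>
  With \<open>M\<close> denoting multiplication by an indicator function and \<open>T\<close>, \<open>T'\<close> the transports
  along a partial isomorphism and its inverse, \<open>T\<close> preserves inner products on the range of
  \<open>M\<^sub>A\<close>, hence \<open>\<langle>T u, v\<rangle> = \<langle>T u, M\<^sub>B v\<rangle> = \<langle>T u, T (T' v)\<rangle> = \<langle>u, M\<^sub>A (T' v)\<rangle> = \<langle>u, T' v\<rangle>\<close>.
\<close>

lemma transport_adjoint:
  assumes iso: "word_partial_iso N A B a b"
    and u: "u \<in> sigma_pairs N // sigma_rel N" and v: "v \<in> sigma_pairs N // sigma_rel N"
  shows "sigma_inner N (sigma_transport N A a b u) v = sigma_inner N u (sigma_transport N B b a v)"
proof -
  interpret i: word_partial_iso N A B a b by fact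
  note iso' = word_partial_iso_sym[OF iso]
  interpret j: word_partial_iso N B A b a by (rule iso')
  let ?T = "sigma_transport N A a b" and ?T' = "sigma_transport N B b a"
  note Tu = i.transport_carrier[OF u] and Tv = j.transport_carrier[OF v]
  have 1: "sigma_restrict N B (?T u) = ?T u"
    by (rule transport_transport[OF iso word_partial_iso_id[OF i.B_sets] iso _ _ u]) (use i.a_in in auto)
  have 2: "?T (?T' v) = sigma_restrict N B v"
    by (rule transport_transport[OF iso' iso word_partial_iso_id[OF i.B_sets] _ _ v])
      (use i.b_in i.a_b in auto)
  have 3: "sigma_restrict N A (?T' v) = ?T' v"
    by (rule transport_transport[OF iso' word_partial_iso_id[OF i.A_sets] iso' _ _ v]) (use i.b_in in auto)
  have 4: "sigma_inner N (?T u) (?T w) = sigma_inner N u (sigma_restrict N A w)"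
    if w: "w \<in> sigma_pairs N // sigma_rel N" for w
  proof -
    obtain \<kappa> f g where f: "(f, \<kappa>) \<in> sigma_pairs N" "u = sigma_fun N f \<kappa>"
      and g: "(g, \<kappa>) \<in> sigma_pairs N" "w = sigma_fun N g \<kappa>" using u w by (rule sigma_pairE)
    show ?thesis
      using f g i.A_sets
      by (simp add: i.inner_transport sigma_restrict_sigma_fun sigma_inner_sigma_fun sigma_pairs_indicator)
        (simp add: mult_ac)
  qed
  have "sigma_inner N (?T u) v = sigma_inner N (sigma_restrict N B (?T u)) v" by (simp only: 1)
  also have "\<dots> = sigma_inner N (?T u) (sigma_restrict N B v)"
    by (rule sigma_restrict_symmetric[OF i.B_sets Tu v])
  also have "\<dots> = sigma_inner N (?T u) (?T (?T' v))" by (simp only: 2)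
  also have "\<dots> = sigma_inner N u (?T' v)" by (simp only: 4[OF Tv] 3)
  finally show ?thesis .
qed

text \<open>Stated for any \<open>T\<close> agreeing with a transport on the carrier, because the
  operators of letters and words are identified with transports only there.\<close>

lemma hadjoint_transport:
  assumes iso: "word_partial_iso N A B a b" and v: "v \<in> sigma_pairs N // sigma_rel N"
    and T: "\<And>u. u \<in> sigma_pairs N // sigma_rel N \<Longrightarrow> T u = sigma_transport N A a b u"
  shows "hadjoint (sigma_space N) T v = sigma_transport N B b a v"
proof -
  interpret complex_hilbert_space "sigma_space N" by (rule hilbert_space_sigma_space)
  interpret j: word_partial_iso N B A b a by (rule word_partial_iso_sym[OF iso])
  show ?thesis
    by (rule hadjoint_eqI) (use j.transport_carrier[OF v] T transport_adjoint[OF iso _ v] in auto)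
qed

lemma shift_funpow: "(shift ^^ n) \<omega> k = \<omega> (k + n)"
  by (induction n arbitrary: k) (auto simp: shift_def)

lemma foldr_prepend: "foldr prepend w \<omega> k = (if k < length w then w ! k else \<omega> (k - length w))"
  by (induction w arbitrary: k) (auto simp: prepend_def split: nat.splits)

text \<open>Prefixing \<open>w\<close> is inverted by deleting as many letters as \<open>w\<close>
  has; the deletion map is a left inverse everywhere and a right inverse on the cylinder.\<close>

lemma word_partial_iso_word:
  assumes w: "set w \<subseteq> {..<N}"
  shows "word_partial_iso N (words N) (cylinder N w) (foldr prepend w) (shift ^^ length w)"
proof
  show "words N \<in> sets (word_borel N)" using sets.top[of "word_borel N"] by simp
  show "cylinder N w \<in> sets (word_borel N)" by (rule cylinder_sets)
  show "foldr prepend w \<in> measurable (word_borel N) (word_borel N)" using w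
  proof (induction w)
    case (Cons i w)
    then show ?case by (simp add: o_def) (rule measurable_compose[OF _ prepend_measurable], auto)
  qed (simp add: id_def)
  show "shift ^^ length w \<in> measurable (word_borel N) (word_borel N)"
  proof (induction "length w")
    case 0
    then show ?case by (simp add: id_def)
  qed (rule measurable_compose_n[OF shift_measurable])
  fix \<omega>
  have "w ! k < N" if "k < length w" for k using w nth_mem[OF that] by auto
  then show "foldr prepend w \<omega> \<in> cylinder N w" if "\<omega> \<in> words N"
    using that by (auto simp: cylinder_def words_def foldr_prepend)
  show "(shift ^^ length w) \<omega> \<in> words N" if "\<omega> \<in> cylinder N w"
    using that by (auto simp: cylinder_def words_def shift_funpow)
  show "(shift ^^ length w) (foldr prepend w \<omega>) = \<omega>"
    by (simp add: fun_eq_iff shift_funpow foldr_prepend)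
  show "foldr prepend w ((shift ^^ length w) \<omega>) = \<omega>" if "\<omega> \<in> cylinder N w"
    using that by (auto simp: fun_eq_iff shift_funpow foldr_prepend cylinder_def)
qed

lemma prepend_image_cylinder:
  assumes "i < N"
  shows "prepend i ` words N = cylinder N [i]"
  unfolding prepend_image_words[OF assms] by (auto simp: cylinder_def)

lemma word_partial_iso_letter:
  assumes "i < N"
  shows "word_partial_iso N (words N) (prepend i ` words N) (prepend i) shift"
  unfolding prepend_image_cylinder[OF assms]
  using word_partial_iso_word[of "[i]" N] assms by simp

lemma restrict_meas_words:
  assumes \<mu>: "\<mu> \<in> finite_word_measures N"
  shows "restrict_meas \<mu> (words N) = \<mu>"
proof -
  have W: "words N \<in> sets \<mu>" using finite_word_measuresD(4)[OF \<mu>] sets.top[of \<mu>] by simp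
  show ?thesis
    unfolding restrict_meas_eq_density[OF W]
  proof (rule measure_eqI)
    fix A assume "A \<in> sets (density \<mu> (indicator (words N)))"
    then have A: "A \<in> sets \<mu>" by simp
    then have "words N \<inter> A = A" using sets.sets_into_space[OF A] finite_word_measuresD(4)[OF \<mu>] by auto
    then show "emeasure (density \<mu> (indicator (words N))) A = emeasure \<mu> A"
      using W A by (simp add: emeasure_restricted)
  qed simp
qed

lemma sigma_S_eq_transport:
  assumes i: "i < N" and u: "u \<in> sigma_pairs N // sigma_rel N"
  shows "sigma_S N i u = sigma_transport N (words N) (prepend i) shift u"
proof -
  obtain f \<mu> where f: "(f, \<mu>) \<in> sigma_pairs N" and u: "u = sigma_fun N f \<mu>"
    using u by (rule sigma_carrierE)
  \<comment> \<open>Restriction to all words changes no representative, so the two definite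
    descriptions have equivalent defining predicates.\<close>
  have "restrict_meas \<nu> (words N) = \<nu>" if "(g, \<nu>) \<in> u" for g \<nu>
    using that restrict_meas_words[OF sigma_pairsD(1)[OF mem_sigma_funD(1)]] u by simp
  then show ?thesis
    unfolding sigma_S_def sigma_transport_def by (intro arg_cong[of _ _ The] ext iff_allI) auto
qed

lemma sigma_S_sigma_fun:
  assumes i: "i < N" and f: "(f, \<mu>) \<in> sigma_pairs N"
  shows "sigma_S N i (sigma_fun N f \<mu>) = sigma_fun N (f \<circ> shift) (distr \<mu> (word_borel N) (prepend i))"
  using sigma_S_eq_transport[OF i sigma_fun_carrier[OF f]]
    word_partial_iso.transport_sigma_fun[OF word_partial_iso_letter[OF i] f]
    restrict_meas_words[OF sigma_pairsD(1)[OF f]] by simp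

lemma hadjoint_sigma_S:
  assumes i: "i < N" and v: "v \<in> sigma_pairs N // sigma_rel N"
  shows "hadjoint (sigma_space N) (sigma_S N i) v =
    sigma_transport N (prepend i ` words N) shift (prepend i) v"
  by (rule hadjoint_transport[OF word_partial_iso_letter[OF i] v sigma_S_eq_transport[OF i]])

lemma word_operator_sigma_S:
  assumes "set w \<subseteq> {..<N}" and u: "u \<in> sigma_pairs N // sigma_rel N"
  shows "word_operator (sigma_S N) w u =
    sigma_transport N (words N) (foldr prepend w) (shift ^^ length w) u"
  using assms(1)
proof (induction w)
  case Nil
  then show ?case using sigma_restrict_words[OF u] by (simp add: word_operator_def id_def)
next
  case (Cons i w)
  then have w: "set w \<subseteq> {..<N}" and i: "i < N" by auto
  note iso = word_partial_iso_word[OF w]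
  have "word_operator (sigma_S N) (i # w) u = sigma_S N i (word_operator (sigma_S N) w u)"
    by (simp add: word_operator_def)
  also have "\<dots> = sigma_transport N (words N) (prepend i) shift
      (sigma_transport N (words N) (foldr prepend w) (shift ^^ length w) u)"
    unfolding Cons.IH[OF w]
    by (rule sigma_S_eq_transport[OF i word_partial_iso.transport_carrier[OF iso u]])
  also have "\<dots> = sigma_transport N (words N) (foldr prepend (i # w)) (shift ^^ length (i # w)) u"
    by (rule transport_transport[OF iso word_partial_iso_letter[OF i] word_partial_iso_word[OF Cons.prems] _ _ u])
      (use word_partial_iso.a_in[OF iso] in \<open>auto simp: cylinder_def\<close>)
  finally show ?case .
qed

text \<open>Deleting the prefix and putting it back is the identity with domain the cylinder. This
  gives both the prescribed cylinder values and, for one-letter words, the terms of the Cuntz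
  sum.\<close>

lemma word_operator_hadjoint_sigma_S:
  assumes w: "set w \<subseteq> {..<N}" and u: "u \<in> sigma_pairs N // sigma_rel N"
  shows "word_operator (sigma_S N) w (hadjoint (sigma_space N) (word_operator (sigma_S N) w) u) =
    sigma_restrict N (cylinder N w) u"
proof -
  note iso = word_partial_iso_word[OF w] and iso' = word_partial_iso_sym[OF word_partial_iso_word[OF w]]
  interpret word_partial_iso N "words N" "cylinder N w" "foldr prepend w" "shift ^^ length w" by (rule iso)
  have "hadjoint (sigma_space N) (word_operator (sigma_S N) w) u =
      sigma_transport N (cylinder N w) (shift ^^ length w) (foldr prepend w) u"
    by (rule hadjoint_transport[OF iso u word_operator_sigma_S[OF w]])
  moreover have "word_operator (sigma_S N) w \<dots> = sigma_transport N (words N) (foldr prepend w) (shift ^^ length w) \<dots>"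
    by (rule word_operator_sigma_S[OF w word_partial_iso.transport_carrier[OF iso' u]])
  moreover have "\<dots> = sigma_restrict N (cylinder N w) u"
    by (rule transport_transport[OF iso' iso word_partial_iso_id[OF cylinder_sets] _ _ u])
      (use b_in a_b in auto)
  ultimately show ?thesis by simp
qed

section \<open>The Cuntz relations\<close>

text \<open>Membership and the value of the sum are proved together, since each addition step
  requires the partial sum to be square integrable.\<close>

lemma finsum_sigma_fun:
  assumes \<kappa>: "\<kappa> \<in> finite_word_measures N" and J: "finite J" and f: "\<And>j. j \<in> J \<Longrightarrow> (f j, \<kappa>) \<in> sigma_pairs N"
  shows "(\<lambda>\<omega>. \<Sum>j\<in>J. f j \<omega>, \<kappa>) \<in> sigma_pairs N \<and>
    (\<Oplus>\<^bsub>sigma_space N\<^esub>j\<in>J. sigma_fun N (f j) \<kappa>) = sigma_fun N (\<lambda>\<omega>. \<Sum>j\<in>J. f j \<omega>) \<kappa>"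
  using J f
proof (induction J)
  case empty
  interpret abelian_group "sigma_space N" by (rule abelian_group_sigma_space)
  show ?case using sigma_pairs_zero[OF \<kappa>] sigma_zero_eq[OF \<kappa>] by simp
next
  case (insert j J)
  interpret abelian_group "sigma_space N" by (rule abelian_group_sigma_space)
  have IH: "(\<lambda>\<omega>. \<Sum>j\<in>J. f j \<omega>, \<kappa>) \<in> sigma_pairs N"
    "(\<Oplus>\<^bsub>sigma_space N\<^esub>j\<in>J. sigma_fun N (f j) \<kappa>) = sigma_fun N (\<lambda>\<omega>. \<Sum>j\<in>J. f j \<omega>) \<kappa>"
    using insert by auto
  have j: "(f j, \<kappa>) \<in> sigma_pairs N" using insert by auto
  have "(\<Oplus>\<^bsub>sigma_space N\<^esub>j\<in>insert j J. sigma_fun N (f j) \<kappa>) =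
      sigma_add N (sigma_fun N (f j) \<kappa>) (\<Oplus>\<^bsub>sigma_space N\<^esub>j\<in>J. sigma_fun N (f j) \<kappa>)"
    using insert by (subst finsum_insert) (auto intro!: sigma_fun_carrier)
  then show ?case
    using insert(1,2) sigma_pairs_add[OF j IH(1)] by (simp add: IH(2) sigma_add_sigma_fun[OF j IH(1)])
qed

lemma cuntz_representation_sigma_S: "cuntz_representation (sigma_space N) N (sigma_S N)"
proof -
  interpret complex_hilbert_space "sigma_space N" by (rule hilbert_space_sigma_space)
  show ?thesis
  proof
    fix i assume i: "i < N"
    note iso = word_partial_iso_letter[OF i]
    interpret i: word_partial_iso N "words N" "prepend i ` words N" "prepend i" shift by (rule iso)
    let ?T = "sigma_transport N (words N) (prepend i) shift"
    have "linear_operator (sigma_space N) (sigma_S N i)"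
      using i.transport_linear unfolding linear_operator_def sigma_space_simps
      by (simp add: sigma_S_eq_transport[OF i] sigma_add_carrier sigma_scale_carrier)
    moreover have "hnorm (sigma_space N) (sigma_S N i u) = hnorm (sigma_space N) u"
      if u: "u \<in> sigma_pairs N // sigma_rel N" for u
    proof -
      \<comment> \<open>Going forth and back is the identity on all words, so moving one operator
        across the inner product yields isometry.\<close>
      have 1: "sigma_transport N (prepend i ` words N) shift (prepend i) (?T u) = sigma_restrict N (words N) u"
        by (rule transport_transport[OF iso word_partial_iso_sym[OF iso] word_partial_iso_id[OF i.A_sets] _ _ u]) auto
      have "sigma_inner N (?T u) (?T u) = sigma_inner N u u"
        by (simp add: transport_adjoint[OF iso u i.transport_carrier[OF u]] 1 sigma_restrict_words[OF u])
      then show ?thesis by (simp add: hnorm_def sigma_S_eq_transport[OF i u])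
    qed
    ultimately show "linear_isometry (sigma_space N) (sigma_S N i)"
      by (simp add: linear_isometry_def)
    fix j x assume j: "j < N" and "x \<in> carrier (sigma_space N)"
    then have x: "x \<in> sigma_pairs N // sigma_rel N" by simp
    note iso' = word_partial_iso_letter[OF j]
    have e: "hadjoint (sigma_space N) (sigma_S N i) (sigma_S N j x) =
      sigma_transport N (prepend i ` words N) shift (prepend i) (sigma_transport N (words N) (prepend j) shift x)"
      by (simp add: sigma_S_eq_transport[OF j x] hadjoint_sigma_S[OF i] word_partial_iso.transport_carrier[OF iso' x])
    show "hadjoint (sigma_space N) (sigma_S N i) (sigma_S N j x) = (if i = j then x else \<zero>\<^bsub>sigma_space N\<^esub>)"
    proof (cases "i = j")
      case True
      have "sigma_transport N (prepend i ` words N) shift (prepend i) (sigma_transport N (words N) (prepend j) shift x)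
          = sigma_restrict N (words N) x"
        by (rule transport_transport[OF iso' word_partial_iso_sym[OF iso] word_partial_iso_id[OF i.A_sets] _ _ x])
          (use True in auto)
      then show ?thesis using e True sigma_restrict_words[OF x] by simp
    next
      case False
      \<comment> \<open>For distinct letters the ranges are disjoint: the composite partial map has
        empty domain, and its transport is multiplication by 0.\<close>
      have n: "prepend j \<omega> \<notin> prepend i ` words N" for \<omega>
        unfolding prepend_image_words[OF i] using False by (simp add: prepend_def)
      have "sigma_transport N (prepend i ` words N) shift (prepend i) (sigma_transport N (words N) (prepend j) shift x)
          = sigma_restrict N {} x"
        by (rule transport_transport[OF iso' word_partial_iso_sym[OF iso] word_partial_iso_id _ _ x])
          (use n in auto)
      moreover obtain f \<mu> where f: "(f, \<mu>) \<in> sigma_pairs N" and "x = sigma_fun N f \<mu>"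
        using x by (rule sigma_carrierE)
      ultimately show ?thesis
        using e False sigma_zero_eq[OF sigma_pairsD(1)[OF f]] by (simp add: sigma_restrict_sigma_fun)
    qed
  next
    fix x assume "x \<in> carrier (sigma_space N)"
    then have x: "x \<in> sigma_pairs N // sigma_rel N" by simp
    then obtain f \<mu> where f: "(f, \<mu>) \<in> sigma_pairs N" and xf: "x = sigma_fun N f \<mu>" by (rule sigma_carrierE)
    have \<mu>: "\<mu> \<in> finite_word_measures N" by (rule sigma_pairsD[OF f])
    let ?f = "\<lambda>i \<omega>. indicator (cylinder N [i]) \<omega> * f \<omega>"
    have term_eq: "sigma_S N i (hadjoint (sigma_space N) (sigma_S N i) x) = sigma_fun N (?f i) \<mu>" if i: "i < N" for i
    proof -
      have "sigma_S N i (hadjoint (sigma_space N) (sigma_S N i) x) = sigma_restrict N (cylinder N [i]) x"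
        using word_operator_hadjoint_sigma_S[of "[i]" N x] i x by (simp add: word_operator_def)
      then show ?thesis by (simp add: xf sigma_restrict_sigma_fun[OF cylinder_sets f])
    qed
    have p: "(?f i, \<mu>) \<in> sigma_pairs N" for i by (rule sigma_pairs_indicator[OF f cylinder_sets])
    note s = finsum_sigma_fun[of \<mu> N "{..<N}" ?f, OF \<mu> finite_lessThan p]
    have "(\<Oplus>\<^bsub>sigma_space N\<^esub>i\<in>{..<N}. sigma_S N i (hadjoint (sigma_space N) (sigma_S N i) x)) =
        (\<Oplus>\<^bsub>sigma_space N\<^esub>i\<in>{..<N}. sigma_fun N (?f i) \<mu>)"
      by (rule finsum_cong') (auto simp: term_eq intro!: sigma_fun_carrier p)
    also have "\<dots> = sigma_fun N (\<lambda>\<omega>. \<Sum>i<N. ?f i \<omega>) \<mu>" using s by blast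
    also have "\<dots> = sigma_fun N f \<mu>"
    proof -
      have "(\<Sum>i<N. ?f i \<omega>) = f \<omega>" if "\<omega> \<in> words N" for \<omega>
      proof -
        \<comment> \<open>A word lies in exactly one of the one-letter cylinders, the one of its
          first letter.\<close>
        have "(\<Sum>i<N. ?f i \<omega>) = (\<Sum>i<N. if i = \<omega> 0 then f \<omega> else 0)"
          using that by (intro sum.cong) (auto simp: cylinder_def indicator_def)
        also have "\<dots> = f \<omega>" using that by (simp add: words_def)
        finally show ?thesis .
      qed
      then have "AE \<omega> in \<mu>. (\<Sum>i<N. ?f i \<omega>) = f \<omega>"
        using finite_word_measuresD(4)[OF \<mu>] by (intro AE_I2) simp
      then show ?thesis using sigma_fun_eq_AE_iff[OF conjunct1[OF s] f] by simp
    qed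
    finally show "(\<Oplus>\<^bsub>sigma_space N\<^esub>i\<in>{..<N}. sigma_S N i (hadjoint (sigma_space N) (sigma_S N i) x)) = x"
      by (simp add: xf)
  qed
qed

section \<open>Existence of the projection valued measure\<close>

text \<open>The projection axioms are composition laws for identity maps. Strong countable
  additivity is dominated convergence with majorant the squared modulus of \<open>f\<close>.\<close>

lemma pvm_sigma_restrict: "projection_valued_measure (sigma_space N) (word_borel N) (sigma_restrict N)"
proof -
  interpret complex_hilbert_space "sigma_space N" by (rule hilbert_space_sigma_space)
  show ?thesis
  proof
    fix A assume A: "A \<in> sets (word_borel N)"
    note iso = word_partial_iso_id[OF A]
    have "sigma_restrict N A (sigma_restrict N A x) = sigma_restrict N A x"
      if "x \<in> sigma_pairs N // sigma_rel N" for x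
      by (rule transport_transport[OF iso iso iso _ _ that]) auto
    then show "orthogonal_projection (sigma_space N) (sigma_restrict N A)"
      using word_partial_iso.transport_linear[OF iso] sigma_restrict_symmetric[OF A]
      by (simp add: orthogonal_projection_def)
  next
    fix A B x assume A: "A \<in> sets (word_borel N)" and B: "B \<in> sets (word_borel N)"
      and "x \<in> carrier (sigma_space N)"
    then have x: "x \<in> sigma_pairs N // sigma_rel N" by simp
    have AB: "A \<inter> B \<in> sets (word_borel N)" using A B by simp
    show "sigma_restrict N (A \<inter> B) x = sigma_restrict N A (sigma_restrict N B x)"
      by (rule transport_transport[symmetric, OF word_partial_iso_id[OF B] word_partial_iso_id[OF A]
            word_partial_iso_id[OF AB] _ _ x]) auto
  next
    fix F :: "nat \<Rightarrow> _" and x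
    assume F: "range F \<subseteq> sets (word_borel N)" and dis: "disjoint_family F" and "x \<in> carrier (sigma_space N)"
    then obtain f \<kappa> where f: "(f, \<kappa>) \<in> sigma_pairs N" and x: "x = sigma_fun N f \<kappa>"
      by (auto elim: sigma_carrierE)
    have \<kappa>: "\<kappa> \<in> finite_word_measures N" by (rule sigma_pairsD[OF f])
    have Fs: "F k \<in> sets (word_borel N)" for k using F by auto
    then have U: "(\<Union>k. F k) \<in> sets (word_borel N)" by auto
    let ?g = "\<lambda>n \<omega>. \<Sum>k<n. indicator (F k) \<omega> * f \<omega>" and ?h = "\<lambda>\<omega>. indicator (\<Union>k. F k) \<omega> * f \<omega>"
    note s = finsum_sigma_fun[of \<kappa> N "{..<n}" "\<lambda>k \<omega>. indicator (F k) \<omega> * f \<omega>" for n,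
        OF \<kappa> finite_lessThan sigma_pairs_indicator[OF f Fs]]
    have g: "(?g n, \<kappa>) \<in> sigma_pairs N" for n using s by blast
    note h = sigma_pairs_indicator[OF f U]
    \<comment> \<open>Disjointness makes the partial sum a single indicator function, which gives
      both the majorant and the pointwise limit.\<close>
    have ge: "?g n \<omega> = indicator (\<Union>k<n. F k) \<omega> * f \<omega>" for n \<omega>
    proof -
      have "(indicator (\<Union>k<n. F k) \<omega> :: complex) = (\<Sum>k<n. indicator (F k) \<omega>)"
        using dis by (intro indicator_UN_disjoint) (auto simp: disjoint_family_on_def)
      then show ?thesis by (simp add: sum_distrib_right)
    qed
    have "(\<lambda>n. LINT \<omega>|\<kappa>. (cmod (?g n \<omega> - ?h \<omega>))\<^sup>2) \<longlonglongrightarrow> (LINT \<omega>|\<kappa>. 0)"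
    proof (rule integral_dominated_convergence[where w = "\<lambda>\<omega>. (cmod (f \<omega>))\<^sup>2"])
      show "integrable \<kappa> (\<lambda>\<omega>. (cmod (f \<omega>))\<^sup>2)" by (rule sigma_pairsD[OF f])
      show "(\<lambda>\<omega>. (cmod (?g n \<omega> - ?h \<omega>))\<^sup>2) \<in> borel_measurable \<kappa>" for n
        using sigma_pairsD(3)[OF sigma_pairs_minus[OF g h]] by (rule borel_measurable_integrable)
      show "AE \<omega> in \<kappa>. norm ((cmod (?g n \<omega> - ?h \<omega>))\<^sup>2) \<le> (cmod (f \<omega>))\<^sup>2" for n
        unfolding ge by (rule AE_I2) (auto simp: indicator_def)
      show "AE \<omega> in \<kappa>. (\<lambda>n. (cmod (?g n \<omega> - ?h \<omega>))\<^sup>2) \<longlonglongrightarrow> 0"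
      proof (rule AE_I2)
        fix \<omega>
        \<comment> \<open>Pointwise the partial sums become constant: from the index after the set
          containing \<open>\<omega>\<close> on, or from the start if there is none.\<close>
        have "\<exists>m. \<forall>n\<ge>m. ?g n \<omega> = ?h \<omega>"
        proof (cases "\<omega> \<in> (\<Union>k. F k)")
          case True
          then obtain k where "\<omega> \<in> F k" by blast
          then show ?thesis unfolding ge by (intro exI[of _ "Suc k"]) (auto simp: indicator_def)
        qed (auto simp: ge indicator_def)
        then have "\<forall>\<^sub>F n in sequentially. (cmod (?g n \<omega> - ?h \<omega>))\<^sup>2 = 0"
          by (auto simp: eventually_sequentially)
        then show "(\<lambda>n. (cmod (?g n \<omega> - ?h \<omega>))\<^sup>2) \<longlonglongrightarrow> 0" by (rule tendsto_eventually)
      qed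
    qed simp
    then have "(\<lambda>n. sqrt (LINT \<omega>|\<kappa>. (cmod (?g n \<omega> - ?h \<omega>))\<^sup>2)) \<longlonglongrightarrow> 0"
      using tendsto_real_sqrt[of _ 0] by simp
    moreover have "hnorm (sigma_space N) (sigma_fun N (?g n) \<kappa> \<ominus>\<^bsub>sigma_space N\<^esub> sigma_fun N ?h \<kappa>) =
        sqrt (LINT \<omega>|\<kappa>. (cmod (?g n \<omega> - ?h \<omega>))\<^sup>2)" for n
      unfolding sigma_minus_sigma_fun[OF g h] by (rule hnorm_sigma_fun[OF sigma_pairs_minus[OF g h]])
    moreover have "(\<Oplus>\<^bsub>sigma_space N\<^esub>k\<in>{..<n}. sigma_restrict N (F k) x) = sigma_fun N (?g n) \<kappa>" for n
      using s by (simp add: x sigma_restrict_sigma_fun[OF Fs f])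
    ultimately show "hconverges (sigma_space N) (\<lambda>n. \<Oplus>\<^bsub>sigma_space N\<^esub>k\<in>{..<n}. sigma_restrict N (F k) x)
        (sigma_restrict N (\<Union>k. F k) x)"
      by (simp add: hconverges_def x sigma_restrict_sigma_fun[OF U f])
  qed (simp add: sigma_restrict_words)
qed

lemma associated_pvm_sigma_restrict: "associated_pvm (sigma_space N) N (sigma_S N) (sigma_restrict N)"
  by (simp add: associated_pvm_def pvm_sigma_restrict word_operator_hadjoint_sigma_S)

section \<open>Uniqueness of the projection valued measure\<close>

text \<open>The pointwise inequality for squares, integrated over a measure common to the three
  vectors, bounds the squared distance of the limits by quantities tending to 0.\<close>

lemma sigma_hconverges_unique:
  assumes u: "\<And>n. u n \<in> sigma_pairs N // sigma_rel N"
    and x: "x \<in> sigma_pairs N // sigma_rel N" and y: "y \<in> sigma_pairs N // sigma_rel N"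
    and lim: "hconverges (sigma_space N) u x" "hconverges (sigma_space N) u y"
  shows "x = y"
proof -
  let ?n = "\<lambda>u v. (hnorm (sigma_space N) (u \<ominus>\<^bsub>sigma_space N\<^esub> v))\<^sup>2"
  have le: "?n x y \<le> 2 * ?n (u n) x + 2 * ?n (u n) y" for n
  proof -
    obtain \<kappa> f g h where f: "(f, \<kappa>) \<in> sigma_pairs N" "x = sigma_fun N f \<kappa>"
      and g: "(g, \<kappa>) \<in> sigma_pairs N" "y = sigma_fun N g \<kappa>"
      and h: "(h, \<kappa>) \<in> sigma_pairs N" "u n = sigma_fun N h \<kappa>" using x y u[of n] by (rule sigma_tripleE)
    have e: "?n (sigma_fun N p \<kappa>) (sigma_fun N q \<kappa>) = (LINT \<omega>|\<kappa>. (cmod (p \<omega> - q \<omega>))\<^sup>2)"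
      if "(p, \<kappa>) \<in> sigma_pairs N" "(q, \<kappa>) \<in> sigma_pairs N" for p q
      using that by (simp add: sigma_minus_sigma_fun hnorm_sigma_fun sigma_pairs_minus)
    note i = sigma_pairsD(3)[OF sigma_pairs_minus]
    have "(LINT \<omega>|\<kappa>. (cmod (f \<omega> - g \<omega>))\<^sup>2) \<le>
        (LINT \<omega>|\<kappa>. 2 * (cmod (h \<omega> - f \<omega>))\<^sup>2 + 2 * (cmod (h \<omega> - g \<omega>))\<^sup>2)"
    proof (rule integral_mono)
      fix \<omega>
      show "(cmod (f \<omega> - g \<omega>))\<^sup>2 \<le> 2 * (cmod (h \<omega> - f \<omega>))\<^sup>2 + 2 * (cmod (h \<omega> - g \<omega>))\<^sup>2"
        using cmod_add_square_le[of "f \<omega> - h \<omega>" "h \<omega> - g \<omega>"] by (simp add: norm_minus_commute)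
    qed (use i[OF f(1) g(1)] i[OF h(1) f(1)] i[OF h(1) g(1)] in auto)
    also have "\<dots> = 2 * (LINT \<omega>|\<kappa>. (cmod (h \<omega> - f \<omega>))\<^sup>2) + 2 * (LINT \<omega>|\<kappa>. (cmod (h \<omega> - g \<omega>))\<^sup>2)"
      using i[OF h(1) f(1)] i[OF h(1) g(1)] by simp
    finally show ?thesis using f g h by (simp add: e)
  qed
  have "(\<lambda>n. 2 * ?n (u n) x + 2 * ?n (u n) y) \<longlonglongrightarrow> 2 * 0\<^sup>2 + 2 * 0\<^sup>2"
    using lim unfolding hconverges_def by (intro tendsto_intros)
  then have "?n x y \<le> 0" using le by (intro LIMSEQ_le_const) auto
  then have z: "hnorm (sigma_space N) (x \<ominus>\<^bsub>sigma_space N\<^esub> y) = 0" by simp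
  obtain \<kappa> f g where f: "(f, \<kappa>) \<in> sigma_pairs N" "x = sigma_fun N f \<kappa>"
    and g: "(g, \<kappa>) \<in> sigma_pairs N" "y = sigma_fun N g \<kappa>" using x y by (rule sigma_pairE)
  note i = sigma_pairsD(3)[OF sigma_pairs_minus[OF f(1) g(1)]]
  have "(LINT \<omega>|\<kappa>. (cmod (f \<omega> - g \<omega>))\<^sup>2) = 0"
    using z unfolding f(2) g(2) sigma_minus_sigma_fun[OF f(1) g(1)] hnorm_sigma_fun[OF sigma_pairs_minus[OF f(1) g(1)]]
    by simp
  then have "AE \<omega> in \<kappa>. (cmod (f \<omega> - g \<omega>))\<^sup>2 = 0"
    using integral_nonneg_eq_0_iff_AE[OF i] by simp
  then have "AE \<omega> in \<kappa>. f \<omega> = g \<omega>" by simp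
  then show ?thesis using f g sigma_fun_eq_AE_iff by metis
qed

text \<open>Two cylinders are nested or disjoint, according to whether the shorter word is a prefix
  of the longer; the empty set is adjoined for the disjoint case.\<close>

lemma Int_stable_cylinders: "Int_stable ({cylinder N w | w. set w \<subseteq> {..<N}} \<union> {{}})"
proof (rule Int_stableI)
  have key: "cylinder N v \<inter> cylinder N w \<in> {cylinder N w | w. set w \<subseteq> {..<N}} \<union> {{}}"
    if len: "length v \<le> length w" and w: "set w \<subseteq> {..<N}" for v w
  proof (cases "\<forall>k<length v. v ! k = w ! k")
    case True
    then have "cylinder N v \<inter> cylinder N w = cylinder N w" using len by (auto simp: cylinder_def)
    then show ?thesis using w by auto
  next
    case False
    then have "cylinder N v \<inter> cylinder N w = {}" using len by (fastforce simp: cylinder_def)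
    then show ?thesis by simp
  qed
  fix A B
  assume A: "A \<in> {cylinder N w | w. set w \<subseteq> {..<N}} \<union> {{}}"
    and B: "B \<in> {cylinder N w | w. set w \<subseteq> {..<N}} \<union> {{}}"
  show "A \<inter> B \<in> {cylinder N w | w. set w \<subseteq> {..<N}} \<union> {{}}"
  proof (cases "A = {} \<or> B = {}")
    case False
    with A B obtain v w where "A = cylinder N v" "B = cylinder N w" "set v \<subseteq> {..<N}" "set w \<subseteq> {..<N}"
      by auto
    then show ?thesis using key[of v w] key[of w v] by (metis Int_commute nat_le_linear)
  qed auto
qed

text \<open>Finite additivity for a set and its complement, obtained by continuing the two sets with
  empty sets: the partial sums are constant from the second on, and limits are unique.\<close>

lemma pvm_add_compl:
  assumes Q: "projection_valued_measure (sigma_space N) (word_borel N) Q"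
    and empty: "Q {} x = \<zero>\<^bsub>sigma_space N\<^esub>"
    and A: "A \<in> sets (word_borel N)" and x: "x \<in> sigma_pairs N // sigma_rel N"
  shows "sigma_add N (Q A x) (Q (words N - A) x) = x"
proof -
  interpret projection_valued_measure "sigma_space N" "word_borel N" Q by (rule Q)
  have W: "words N \<in> sets (word_borel N)" using sets.top[of "word_borel N"] by simp
  have Qc: "Q B x \<in> sigma_pairs N // sigma_rel N" if "B \<in> sets (word_borel N)" for B
    using pvm_projection[OF that] x by (simp add: orthogonal_projection_def linear_operator_def)
  define F where "F k = (if k = 0 then A else if k = 1 then words N - A else {})" for k :: nat
  have Fs: "F k \<in> sets (word_borel N)" for k using A W by (simp add: F_def sets.Diff)
  have sub: "A \<subseteq> words N" using sets.sets_into_space[OF A] by simp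
  have "(\<Union>k. F k) = words N"
  proof
    show "words N \<subseteq> (\<Union>k. F k)"
    proof
      fix \<omega> assume "\<omega> \<in> words N"
      then have "\<omega> \<in> F 0 \<or> \<omega> \<in> F 1" by (auto simp: F_def)
      then show "\<omega> \<in> (\<Union>k. F k)" by blast
    qed
  qed (use sub in \<open>auto simp: F_def split: if_splits\<close>)
  moreover have "disjoint_family F" by (auto simp: disjoint_family_on_def F_def split: if_splits)
  ultimately have lim: "hconverges (sigma_space N) (\<lambda>n. \<Oplus>\<^bsub>sigma_space N\<^esub>k\<in>{..<n}. Q (F k) x) x"
    using pvm_countably_additive[of F x] Fs x pvm_space[of x] by auto
  let ?c = "sigma_add N (Q A x) (Q (words N - A) x)"
  have Ac: "words N - A \<in> sets (word_borel N)" using A W by (rule sets.Diff[rotated])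
  have c: "?c \<in> sigma_pairs N // sigma_rel N" by (intro sigma_add_carrier Qc A Ac)
  have S: "(\<Oplus>\<^bsub>sigma_space N\<^esub>k\<in>{..<Suc n}. Q (F k) x) =
      sigma_add N (Q (F n) x) (\<Oplus>\<^bsub>sigma_space N\<^esub>k\<in>{..<n}. Q (F k) x)" for n
    unfolding lessThan_Suc using Qc[OF Fs] by (subst finsum_insert) auto
  have "(\<Oplus>\<^bsub>sigma_space N\<^esub>k\<in>{..<Suc (Suc n)}. Q (F k) x) = ?c" for n
  proof (induction n)
    case 0
    have "(\<Oplus>\<^bsub>sigma_space N\<^esub>k\<in>{..<Suc 0}. Q (F k) x) = Q (F 0) x"
      unfolding S using Qc[OF Fs, of 0] r_zero[of "Q (F 0) x"] by simp
    then show ?case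
      unfolding S[of "Suc 0"] using a_comm[of "Q A x" "Q (words N - A) x"] Qc[OF A] Qc[OF Ac]
      by (simp add: F_def)
  next
    case (Suc n)
    then show ?case
      unfolding S[of "Suc (Suc n)"] using l_zero[of ?c] c by (simp add: F_def empty)
  qed
  \<comment> \<open>Two terms are required before both \<open>A\<close> and its complement have been
    added.\<close>
  then have ev: "(\<Oplus>\<^bsub>sigma_space N\<^esub>k\<in>{..<n}. Q (F k) x) = ?c" if "n \<ge> 2" for n
    using that by (metis add_2_eq_Suc le_Suc_ex)
  obtain h \<kappa> where h: "(h, \<kappa>) \<in> sigma_pairs N" "?c = sigma_fun N h \<kappa>" using c by (rule sigma_carrierE)
  have "hnorm (sigma_space N) (?c \<ominus>\<^bsub>sigma_space N\<^esub> ?c) = 0"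
    unfolding h(2) sigma_minus_sigma_fun[OF h(1) h(1)] hnorm_sigma_fun[OF sigma_pairs_minus[OF h(1) h(1)]]
    by simp
  then have "\<forall>\<^sub>F n in sequentially. hnorm (sigma_space N)
      ((\<Oplus>\<^bsub>sigma_space N\<^esub>k\<in>{..<n}. Q (F k) x) \<ominus>\<^bsub>sigma_space N\<^esub> ?c) = 0"
    using ev by (auto simp: eventually_sequentially intro!: exI[of _ 2])
  then have "hconverges (sigma_space N) (\<lambda>n. \<Oplus>\<^bsub>sigma_space N\<^esub>k\<in>{..<n}. Q (F k) x) ?c"
    unfolding hconverges_def by (rule tendsto_eventually)
  moreover have "(\<Oplus>\<^bsub>sigma_space N\<^esub>k\<in>{..<n}. Q (F k) x) \<in> sigma_pairs N // sigma_rel N" for n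
    using finsum_closed[of "\<lambda>k. Q (F k) x" "{..<n}"] Qc[OF Fs] by auto
  ultimately show ?thesis
    using sigma_hconverges_unique[OF _ c x _ lim] by blast
qed

text \<open>Dynkin's induction over the intersection-stable generator. Agreement passes to
  complements by cancellation in the additive group and to disjoint unions by uniqueness of
  limits.\<close>

lemma associated_pvm_unique:
  assumes P: "associated_pvm (sigma_space N) N (sigma_S N) P" and N: "N \<ge> 2"
    and A: "A \<in> sets (word_borel N)" and x: "x \<in> sigma_pairs N // sigma_rel N"
  shows "P A x = sigma_restrict N A x"
proof -
  interpret P: projection_valued_measure "sigma_space N" "word_borel N" P
    using P by (simp add: associated_pvm_def)
  interpret M: projection_valued_measure "sigma_space N" "word_borel N" "sigma_restrict N"
    by (rule pvm_sigma_restrict)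
  have cyl: "P (cylinder N w) y = sigma_restrict N (cylinder N w) y"
    if "set w \<subseteq> {..<N}" "y \<in> sigma_pairs N // sigma_rel N" for w y
    using P that word_operator_hadjoint_sigma_S[OF that] by (simp add: associated_pvm_def)
  have Pc: "P B y \<in> sigma_pairs N // sigma_rel N"
    if "B \<in> sets (word_borel N)" "y \<in> sigma_pairs N // sigma_rel N" for B y
    using P.pvm_projection[OF that(1)] that(2) by (simp add: orthogonal_projection_def linear_operator_def)
  let ?C = "{cylinder N w | w. set w \<subseteq> {..<N}} \<union> {{}}"
  have sub: "?C \<subseteq> Pow (words N)" by (auto simp: cylinder_def)
  have sC: "sigma_sets (words N) ?C = sets (word_borel N)"
  proof
    show "sigma_sets (words N) ?C \<subseteq> sets (word_borel N)"
      using sets.sigma_sets_subset[of ?C "word_borel N", unfolded space_word_borel] cylinder_sets by blast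
    show "sets (word_borel N) \<subseteq> sigma_sets (words N) ?C"
      unfolding sets_word_borel_cylinders by (rule sigma_sets_mono') auto
  qed
  \<comment> \<open>The letters 0 and 1 exist because \<open>N \<ge> 2\<close>. Their cylinders are
    disjoint, so multiplicativity expresses the value at the empty set through prescribed cylinder
    values.\<close>
  have empty: "P {} y = sigma_restrict N {} y" if y: "y \<in> sigma_pairs N // sigma_rel N" for y
  proof -
    have e: "cylinder N [0] \<inter> cylinder N [1] = {}" by (auto simp: cylinder_def)
    have "P {} y = P (cylinder N [0]) (P (cylinder N [1]) y)"
      using P.pvm_Int[OF cylinder_sets cylinder_sets, of y "[0]" "[1]"] y e by simp
    also have "\<dots> = sigma_restrict N (cylinder N [0]) (sigma_restrict N (cylinder N [1]) y)"
      using N y by (simp add: cyl sigma_restrict_carrier[OF cylinder_sets])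
    also have "\<dots> = sigma_restrict N {} y"
      using M.pvm_Int[OF cylinder_sets cylinder_sets, of y "[0]" "[1]"] y e by simp
    finally show ?thesis .
  qed
  have zero: "sigma_restrict N {} y = \<zero>\<^bsub>sigma_space N\<^esub>" if y: "y \<in> sigma_pairs N // sigma_rel N" for y
  proof -
    obtain f \<mu> where f: "(f, \<mu>) \<in> sigma_pairs N" "y = sigma_fun N f \<mu>" using y by (rule sigma_carrierE)
    then show ?thesis using sigma_zero_eq[OF sigma_pairsD(1)[OF f(1)]] by (simp add: sigma_restrict_sigma_fun)
  qed
  show ?thesis
    using Int_stable_cylinders sub A[folded sC] x
  proof (induction arbitrary: x rule: sigma_sets_induct_disjoint)
    case (basic A)
    then show ?case using cyl empty by auto
  next
    case empty
    then show ?case using \<open>\<And>y. y \<in> sigma_pairs N // sigma_rel N \<Longrightarrow> P {} y = sigma_restrict N {} y\<close> by simp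
  next
    case (compl A)
    then have A: "A \<in> sets (word_borel N)" and x: "x \<in> sigma_pairs N // sigma_rel N" using sC by auto
    have Ac: "words N - A \<in> sets (word_borel N)" using sets.compl_sets[OF A] by simp
    \<comment> \<open>Each measure splits \<open>x\<close> into its parts for \<open>A\<close> and
      the complement; the parts for \<open>A\<close> agree by induction and cancel.\<close>
    have "sigma_add N (sigma_restrict N A x) (P (words N - A) x) =
        sigma_add N (sigma_restrict N A x) (sigma_restrict N (words N - A) x)"
      using pvm_add_compl[OF P.projection_valued_measure_axioms _ A x]
        pvm_add_compl[OF M.projection_valued_measure_axioms zero[OF x] A x]
        compl.IH[OF x] empty[OF x] zero[OF x] by simp
    then show ?case
      using P.add.l_cancel[of "sigma_restrict N A x" "P (words N - A) x" "sigma_restrict N (words N - A) x"]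
        Pc[OF Ac x] sigma_restrict_carrier[OF Ac x] sigma_restrict_carrier[OF A x] by simp
  next
    case (union F)
    then have F: "range F \<subseteq> sets (word_borel N)" and dis: "disjoint_family F"
      and x: "x \<in> sigma_pairs N // sigma_rel N" using sC by auto
    have U: "(\<Union>k. F k) \<in> sets (word_borel N)" using F by auto
    have e: "P (F k) x = sigma_restrict N (F k) x" for k using union.IH x by simp
    have Mc: "sigma_restrict N (F k) x \<in> sigma_pairs N // sigma_rel N" for k
      using F x by (intro sigma_restrict_carrier) auto
    show ?case
    \<comment> \<open>By the induction hypothesis both measures have the same partial sums, which
      converge to both values at the union.\<close>
    proof (rule sigma_hconverges_unique)
      show "hconverges (sigma_space N) (\<lambda>n. \<Oplus>\<^bsub>sigma_space N\<^esub>k\<in>{..<n}. sigma_restrict N (F k) x)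
          (P (\<Union>k. F k) x)"
        using P.pvm_countably_additive[OF F dis, of x] x by (simp add: e)
      show "hconverges (sigma_space N) (\<lambda>n. \<Oplus>\<^bsub>sigma_space N\<^esub>k\<in>{..<n}. sigma_restrict N (F k) x)
          (sigma_restrict N (\<Union>k. F k) x)"
        using M.pvm_countably_additive[OF F dis, of x] x by simp
      show "(\<Oplus>\<^bsub>sigma_space N\<^esub>k\<in>{..<n}. sigma_restrict N (F k) x) \<in> sigma_pairs N // sigma_rel N" for n
        using P.finsum_closed[of "\<lambda>k. sigma_restrict N (F k) x" "{..<n}"] Mc by auto
    qed (intro Pc sigma_restrict_carrier U x)+
  qed
qed

theorem proposition4p2:
  fixes N :: nat
  assumes "N \<ge> 2"
  shows
    "(\<forall>i<N. \<forall>(f, \<mu>)\<in>sigma_pairs N.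
        sigma_S N i (sigma_fun N f \<mu>) =
          sigma_fun N (f \<circ> shift) (distr \<mu> (word_borel N) (prepend i))) \<and>
     cuntz_representation (sigma_space N) N (sigma_S N) \<and>
     (\<forall>i<N. \<forall>(f, \<mu>)\<in>sigma_pairs N.
        hadjoint (sigma_space N) (sigma_S N i) (sigma_fun N f \<mu>) =
          sigma_fun N (f \<circ> prepend i)
            (distr (restrict_meas \<mu> (prepend i ` words N)) (word_borel N) shift)) \<and>
     (\<exists>P. associated_pvm (sigma_space N) N (sigma_S N) P) \<and>
     (\<forall>P. associated_pvm (sigma_space N) N (sigma_S N) P \<longrightarrow>
        (\<forall>A\<in>sets (word_borel N). \<forall>(f, \<mu>)\<in>sigma_pairs N.
           P A (sigma_fun N f \<mu>) = sigma_fun N (\<lambda>\<omega>. indicator A \<omega> * f \<omega>) \<mu>))"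
proof (intro conjI)
  show "\<forall>i<N. \<forall>(f, \<mu>)\<in>sigma_pairs N.
      sigma_S N i (sigma_fun N f \<mu>) = sigma_fun N (f \<circ> shift) (distr \<mu> (word_borel N) (prepend i))"
    using sigma_S_sigma_fun by blast
  show "cuntz_representation (sigma_space N) N (sigma_S N)" by (rule cuntz_representation_sigma_S)
  show "\<forall>i<N. \<forall>(f, \<mu>)\<in>sigma_pairs N.
      hadjoint (sigma_space N) (sigma_S N i) (sigma_fun N f \<mu>) =
        sigma_fun N (f \<circ> prepend i)
          (distr (restrict_meas \<mu> (prepend i ` words N)) (word_borel N) shift)"
  proof clarify
    fix i f \<mu> assume i: "i < N" and f: "(f, \<mu>) \<in> sigma_pairs N"
    show "hadjoint (sigma_space N) (sigma_S N i) (sigma_fun N f \<mu>) =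
        sigma_fun N (f \<circ> prepend i) (distr (restrict_meas \<mu> (prepend i ` words N)) (word_borel N) shift)"
      unfolding hadjoint_sigma_S[OF i sigma_fun_carrier[OF f]]
      by (rule word_partial_iso.transport_sigma_fun[OF word_partial_iso_sym[OF word_partial_iso_letter[OF i]] f])
  qed
  show "\<exists>P. associated_pvm (sigma_space N) N (sigma_S N) P"
    using associated_pvm_sigma_restrict by blast
  show "\<forall>P. associated_pvm (sigma_space N) N (sigma_S N) P \<longrightarrow>
      (\<forall>A\<in>sets (word_borel N). \<forall>(f, \<mu>)\<in>sigma_pairs N.
        P A (sigma_fun N f \<mu>) = sigma_fun N (\<lambda>\<omega>. indicator A \<omega> * f \<omega>) \<mu>)"
  proof clarify
    fix P A f \<mu> assume P: "associated_pvm (sigma_space N) N (sigma_S N) P"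
      and A: "A \<in> sets (word_borel N)" and f: "(f, \<mu>) \<in> sigma_pairs N"
    show "P A (sigma_fun N f \<mu>) = sigma_fun N (\<lambda>\<omega>. indicator A \<omega> * f \<omega>) \<mu>"
      using associated_pvm_unique[OF P assms A sigma_fun_carrier[OF f]] sigma_restrict_sigma_fun[OF A f] by simp
  qed
qed

end
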